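(* Let $\mathcal T_0$ be an initial AMP marked mesh, let $\mathcal T$ be a conformingly marked AMP descendant mesh of $\mathcal T_0$, let $\mathcal M\subseteq\mathcal T$ be a marking set, and let $\mathcal T^+=\mathtt{RefineAMP}(\mathcal T,\mathcal M)$. For every $T\in\mathcal T^+\setminus\mathcal T$ there is a causal root $M\in\mathcal M$ (the root of a causal chain ending at the bisection event whose child is $T$) such that $$\operatorname{lvl}(T)\le\operatorname{lvl}(M)+1,\qquad \operatorname{dist}(T,M)\le R_{\mathrm{AMP}}\,2^{-\operatorname{lvl}(T)},$$ where $R_{\mathrm{AMP}}:=4H_{\mathrm{AMP}}C_h$, $H_{\mathrm{AMP}}:=\max\{448\,\#\mathcal T_0,\,630\,\nu\}$, and $C_h$, $\nu$ are the constants defined in the context.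
   Context: **Notation.** Tetrahedra are closed and nondegenerate in $\mathbb R^3$; $[v_0,v_1,\dots]$ is the convex hull; $\mathcal V(X),\mathcal E(X),\mathcal F(X)$ are the sets of vertices, edges, triangular faces of a tetrahedron or mesh $X$; $\operatorname{mid}(e)$ is the midpoint of $e$; $\operatorname{dist}(X,Y)=\inf\{|x-y|:x\in X,y\in Y\}$. **Marked tetrahedron.** A tetrahedron $K$ with a refinement edge $e(K)\in\mathcal E(K)$, a marked edge $\mu_F\in\mathcal E(F)$ for every $F\in\mathcal F(K)$, and a Boolean flag, such that the two faces containing $e(K)$ (refinement faces) have mark $e(K)$; the flag may be set only if the four face marks are coplanar. The other two faces are the nonrefinement faces. Types: $P$ if all face marks are coplanar ($P_u$ flag unset, $P_f$ flag set); $A$ if the marks of both nonrefinement faces meet $e(K)$ but the four marks are not coplanar; $O$ if neither of these two marks meets $e(K)$; $M$ if exactly one does. **Bisection.** For $K=[v_0,v_1,v_2,v_3]$ with $e(K)=[v_0,v_1]$ and $m=\operatorname{mid}([v_0,v_1])$, the children are $K_0=[v_0,m,v_2,v_3]$ and $K_1=[m,v_1,v_2,v_3]$, marked as follows: (B1) the inherited face of a child (a face of $K$) keeps its mark, and this mark is the refinement edge of the child; (B2) a cut face (a proper subtriangle of a face of $K$) is marked by its edge opposite $m$; (B3) the common new face $[m,v_2,v_3]$ is marked by $[v_2,v_3]$, except if $K$ has type $P_f$, when it is marked by $[m,w]$ with $w\in\{v_2,v_3\}$ the common old endpoint of the two child refinement edges; (B4) the child flags are set iff $K$ has type $P_u$.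 **Meshes.** A tetrahedral mesh of a polyhedral domain $\Omega\subset\mathbb R^3$ is a finite collection of tetrahedra with pairwise disjoint interiors and union $\overline\Omega$. It is conforming if two distinct elements intersect in the empty set, a common vertex, a common edge or a common face. An AMP marked mesh is a mesh of marked tetrahedra; it is conformingly marked if it is conforming and any shared face gets the same mark from both sides. An *initial AMP marked mesh* is a finite conformingly marked AMP mesh with all flags unset. Repeated bisection generates a binary tree below each $K\in\mathcal T_0$; its nodes are the AMP descendants, $\operatorname{gen}(K)$ is the depth of $K$, and $\operatorname{lvl}(K)=\lfloor\operatorname{gen}(K)/3\rfloor$. A descendant mesh of $\mathcal T_0$ is the mesh of leaves after finitely many bisections starting from $\mathcal T_0$. **RefineAMP.** A hanging vertex of an element $K$ of a current mesh $\mathcal T$ is a vertex $z\in\mathcal V(\mathcal T)$ with $z\in\partial K\setminus\mathcal V(K)$. $\mathtt{RefineAMP}(\mathcal T,\mathcal M)$, for a conformingly marked AMP mesh $\mathcal T$ and $\mathcal M\subseteq\mathcal T$: batch zero bisects all elements of $\mathcal M$; then, as long as some elements of the current mesh have hanging vertices, the next batch simultaneously bisects all of them; return the resulting mesh. (Known: calls terminate with a conformingly marked mesh.) **Causal forest.** Fix one call. Every bisection performed is an event (identified with the tetrahedron bisected); the events of batch zero (bisecting the elements of $\mathcal M$) are the roots. For every non-root event, bisecting $K$, there exist an edge $e\in\mathcal E(K)$ such that $\operatorname{mid}(e)$ is a hanging vertex of $K$ immediately before the event, and an earlier event of the same call that bisected exactly the geometric edge $e$, creating $\operatorname{mid}(e)$.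 Choose one such earlier event for each non-root event and call it the parent. The resulting directed graph is a causal forest of the call, and a causal chain is a directed path in it. **Constants.** $\mathcal U_q$ is the mesh obtained by bisecting uniformly $3q$ times every element of $\mathcal T_0$ (all $\mathcal U_q$ are conforming). $\nu:=\sup_{q\ge0}\sup_{z\in\mathcal V(\mathcal U_q)}\#\{K\in\mathcal U_q:z\in\mathcal V(K)\}<\infty$. $C_h>0$ is a fixed constant depending only on $\mathcal T_0$ such that $\operatorname{diam}(K)\le C_h2^{-\operatorname{lvl}(K)}$ for every AMP descendant $K$ of $\mathcal T_0$ (such a constant exists). *)

theory Defs
  imports "HOL-Analysis.Analysis"
begin

type_synonym point = "real ^ 3"

text \<open>
  A nondegenerate tetrahedron, and each of its edges and faces, is represented by its vertex set,
  which it determines (the vertices are its extreme points) and whose convex hull it is.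
\<close>

definition tetrahedron :: "point set \<Rightarrow> bool" where
  "tetrahedron V \<longleftrightarrow> card V = 4 \<and> \<not> affine_dependent V"

definition edges_of :: "point set \<Rightarrow> point set set" where
  "edges_of V = {e. e \<subseteq> V \<and> card e = 2}"

definition faces_of :: "point set \<Rightarrow> point set set" where
  "faces_of V = {F. F \<subseteq> V \<and> card F = 3}"

definition mid :: "point set \<Rightarrow> point" where
  "mid e = (1 / 2) *\<^sub>R (\<Sum>v\<in>e. v)"

lemma mid_edge: "a \<noteq> b \<Longrightarrow> mid {a, b} = midpoint a b"
  by (simp add: mid_def midpoint_def)


record marked_tet =
  verts :: "point set"
  refedge :: "point set"
  mark :: "point set \<Rightarrow> point set"
  flag :: bool

definition body :: "marked_tet \<Rightarrow> point set" where
  "body K = convex hull (verts K)"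

abbreviation edges :: "marked_tet \<Rightarrow> point set set" where
  "edges K \<equiv> edges_of (verts K)"

abbreviation faces :: "marked_tet \<Rightarrow> point set set" where
  "faces K \<equiv> faces_of (verts K)"

definition coplanar_marks :: "marked_tet \<Rightarrow> bool" where
  "coplanar_marks K \<longleftrightarrow> coplanar (\<Union>F\<in>faces K. convex hull (mark K F))"

text \<open>
  The marking is normalised to the empty set outside the four faces, so that equality of records
  is equality of marked tetrahedra.
\<close>

definition marked_tetrahedron :: "marked_tet \<Rightarrow> bool" where
  "marked_tetrahedron K \<longleftrightarrow>
     tetrahedron (verts K) \<and>
     refedge K \<in> edges K \<and>
     (\<forall>F\<in>faces K. mark K F \<in> edges_of F) \<and>
     (\<forall>F. F \<notin> faces K \<longrightarrow> mark K F = {}) \<and>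
     (\<forall>F\<in>faces K. refedge K \<subseteq> F \<longrightarrow> mark K F = refedge K) \<and>
     (flag K \<longrightarrow> coplanar_marks K)"

definition type_Pu :: "marked_tet \<Rightarrow> bool" where
  "type_Pu K \<longleftrightarrow> coplanar_marks K \<and> \<not> flag K"

definition type_Pf :: "marked_tet \<Rightarrow> bool" where
  "type_Pf K \<longleftrightarrow> coplanar_marks K \<and> flag K"


text \<open>
  For an endpoint \<open>v\<close> of the refinement edge, \<open>child K v\<close> is the child of \<open>K\<close> that keeps \<open>v\<close>, and
  \<open>inherited_face K v\<close> is the face of \<open>K\<close> that is also a face of this child.
\<close>

definition inherited_face :: "marked_tet \<Rightarrow> point \<Rightarrow> point set" where
  "inherited_face K v = verts K - (refedge K - {v})"

definition new_face :: "marked_tet \<Rightarrow> point set" where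
  "new_face K = insert (mid (refedge K)) (verts K - refedge K)"

text \<open>
  The common old endpoint of the refinement edges of the two children; it exists and is unique
  for type \<open>P\<close>.
\<close>

definition common_endpoint :: "marked_tet \<Rightarrow> point" where
  "common_endpoint K =
     (THE w. w \<in> verts K - refedge K \<and> (\<forall>v\<in>refedge K. w \<in> mark K (inherited_face K v)))"

definition child :: "marked_tet \<Rightarrow> point \<Rightarrow> marked_tet" where
  "child K v =
     (let m = mid (refedge K); W = insert m (inherited_face K v) in
      \<lparr> verts = W,
        refedge = mark K (inherited_face K v),
        mark = (\<lambda>F. if F \<notin> faces_of W then {}
                    else if F = inherited_face K v then mark K F
                    else if F = new_face K then
                      (if type_Pf K then {m, common_endpoint K} else verts K - refedge K)
                    else F - {m}),
        flag = type_Pu K \<rparr>)"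

definition children :: "marked_tet \<Rightarrow> marked_tet set" where
  "children K = child K ` refedge K"

definition bisect :: "marked_tet set \<Rightarrow> marked_tet set \<Rightarrow> marked_tet set" where
  "bisect T B = (T - B) \<union> (\<Union>K\<in>B. children K)"


definition polyhedral_domain :: "point set \<Rightarrow> bool" where
  "polyhedral_domain \<Omega> \<longleftrightarrow>
     open \<Omega> \<and> connected \<Omega> \<and> \<Omega> \<noteq> {} \<and> bounded \<Omega> \<and>
     (\<exists>P. finite P \<and> (\<forall>p\<in>P. polytope p) \<and> frontier \<Omega> = \<Union>P)"

definition marked_mesh :: "point set \<Rightarrow> marked_tet set \<Rightarrow> bool" where
  "marked_mesh \<Omega> T \<longleftrightarrow>
     finite T \<and> (\<forall>K\<in>T. marked_tetrahedron K) \<and>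
     (\<forall>K\<in>T. \<forall>K'\<in>T. K \<noteq> K' \<longrightarrow> interior (body K) \<inter> interior (body K') = {}) \<and>
     (\<Union>K\<in>T. body K) = closure \<Omega>"

definition conforming :: "marked_tet set \<Rightarrow> bool" where
  "conforming T \<longleftrightarrow>
     (\<forall>K\<in>T. \<forall>K'\<in>T. K \<noteq> K' \<longrightarrow>
        body K \<inter> body K' = {} \<or>
        (\<exists>v \<in> verts K \<inter> verts K'. body K \<inter> body K' = {v}) \<or>
        (\<exists>e \<in> edges K \<inter> edges K'. body K \<inter> body K' = convex hull e) \<or>
        (\<exists>F \<in> faces K \<inter> faces K'. body K \<inter> body K' = convex hull F))"

definition conformingly_marked :: "marked_tet set \<Rightarrow> bool" where
  "conformingly_marked T \<longleftrightarrow>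
     conforming T \<and>
     (\<forall>K\<in>T. \<forall>K'\<in>T. \<forall>F \<in> faces K \<inter> faces K'. mark K F = mark K' F)"

definition initial_mesh :: "point set \<Rightarrow> marked_tet set \<Rightarrow> bool" where
  "initial_mesh \<Omega> T0 \<longleftrightarrow>
     marked_mesh \<Omega> T0 \<and> conformingly_marked T0 \<and> (\<forall>K\<in>T0. \<not> flag K)"

inductive descendant_mesh :: "marked_tet set \<Rightarrow> marked_tet set \<Rightarrow> bool"
  for T0 :: "marked_tet set" where
  initial: "descendant_mesh T0 T0"
| bisection: "descendant_mesh T0 T \<Longrightarrow> K \<in> T \<Longrightarrow> descendant_mesh T0 (bisect T {K})"


text \<open>
  Bisecting every element \<open>n\<close> times yields exactly the nodes of depth \<open>n\<close> of the bisection forest.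
  The depth of a node is unique, since distinct nodes are distinct marked tetrahedra.
\<close>

primrec uniform :: "marked_tet set \<Rightarrow> nat \<Rightarrow> marked_tet set" where
  "uniform T0 0 = T0"
| "uniform T0 (Suc n) = bisect (uniform T0 n) (uniform T0 n)"

definition descendants :: "marked_tet set \<Rightarrow> marked_tet set" where
  "descendants T0 = (\<Union>n. uniform T0 n)"

definition gen :: "marked_tet set \<Rightarrow> marked_tet \<Rightarrow> nat" where
  "gen T0 K = (THE n. K \<in> uniform T0 n)"

definition lvl :: "marked_tet set \<Rightarrow> marked_tet \<Rightarrow> nat" where
  "lvl T0 K = gen T0 K div 3"


definition vertices :: "marked_tet set \<Rightarrow> point set" where
  "vertices T = (\<Union>K\<in>T. verts K)"

definition hanging_vertices :: "marked_tet set \<Rightarrow> marked_tet \<Rightarrow> point set" where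
  "hanging_vertices T K = {z \<in> vertices T. z \<in> frontier (body K) - verts K}"

definition hanging_elements :: "marked_tet set \<Rightarrow> marked_tet set" where
  "hanging_elements T = {K \<in> T. hanging_vertices T K \<noteq> {}}"

text \<open>
  \<open>call_mesh T MM n\<close> is the mesh immediately before batch \<open>n\<close> of the call with marking set \<open>MM\<close>.
  Once the loop has stopped, all further batches are empty and the mesh stays constant.
\<close>

primrec call_mesh :: "marked_tet set \<Rightarrow> marked_tet set \<Rightarrow> nat \<Rightarrow> marked_tet set" where
  "call_mesh T MM 0 = T"
| "call_mesh T MM (Suc n) =
     bisect (call_mesh T MM n) (if n = 0 then MM else hanging_elements (call_mesh T MM n))"

definition batch :: "marked_tet set \<Rightarrow> marked_tet set \<Rightarrow> nat \<Rightarrow> marked_tet set" where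
  "batch T MM n = (if n = 0 then MM else hanging_elements (call_mesh T MM n))"

definition refine_AMP :: "marked_tet set \<Rightarrow> marked_tet set \<Rightarrow> marked_tet set" where
  "refine_AMP T MM =
     call_mesh T MM (LEAST n. n \<ge> 1 \<and> hanging_elements (call_mesh T MM n) = {})"


definition events :: "marked_tet set \<Rightarrow> marked_tet set \<Rightarrow> marked_tet set" where
  "events T MM = (\<Union>n. batch T MM n)"

definition possible_parent ::
  "marked_tet set \<Rightarrow> marked_tet set \<Rightarrow> marked_tet \<Rightarrow> marked_tet \<Rightarrow> bool" where
  "possible_parent T MM K' K \<longleftrightarrow>
     (\<exists>n n'. n' < n \<and> K \<in> batch T MM n \<and> K' \<in> batch T MM n' \<and>
        (\<exists>e\<in>edges K. mid e \<in> hanging_vertices (call_mesh T MM n) K \<and> refedge K' = e))"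

text \<open>
  A causal forest is given by a choice \<open>par\<close> of a parent for every non-root event; the values of
  \<open>par\<close> elsewhere are irrelevant.
\<close>

definition causal_forest ::
  "marked_tet set \<Rightarrow> marked_tet set \<Rightarrow> (marked_tet \<Rightarrow> marked_tet) \<Rightarrow> bool" where
  "causal_forest T MM par \<longleftrightarrow> (\<forall>K \<in> events T MM - MM. possible_parent T MM (par K) K)"

definition causal_edge ::
  "marked_tet set \<Rightarrow> marked_tet set \<Rightarrow> (marked_tet \<Rightarrow> marked_tet) \<Rightarrow> marked_tet \<Rightarrow> marked_tet \<Rightarrow> bool"
  where "causal_edge T MM par K' K \<longleftrightarrow> K \<in> events T MM - MM \<and> K' = par K"

definition causal_chain ::
  "marked_tet set \<Rightarrow> marked_tet set \<Rightarrow> (marked_tet \<Rightarrow> marked_tet) \<Rightarrow> marked_tet \<Rightarrow> marked_tet \<Rightarrow> bool"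
  where "causal_chain T MM par = (causal_edge T MM par)\<^sup>*\<^sup>*"


text \<open>The supremum is taken in the extended naturals, hence needs no boundedness proviso.\<close>

definition nu :: "marked_tet set \<Rightarrow> enat" where
  "nu T0 = (SUP q. SUP z \<in> vertices (uniform T0 (3 * q)).
      enat (card {K \<in> uniform T0 (3 * q). z \<in> verts K}))"

definition H_AMP :: "marked_tet set \<Rightarrow> ereal" where
  "H_AMP T0 = max (448 * ereal (real (card T0))) (630 * ereal_of_enat (nu T0))"

definition R_AMP :: "marked_tet set \<Rightarrow> real \<Rightarrow> ereal" where
  "R_AMP T0 Ch = 4 * H_AMP T0 * ereal Ch"

end

theory Submission
  imports Defs
begin

text \<open>
  The meshes \<open>uniform T0 (3 * q)\<close> are conforming and consist of unflagged tetrahedra, and bisecting such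
  a tetrahedron three times bisects each of its six edges. Hence an edge belongs to exactly one of
  these meshes. The edge that an event passes to its causal successor is an edge of the successor,
  and the successor's level is therefore at most that of the event; this bounds the level of \<open>T\<close>.

  For the distance it suffices to bound the number of events of one level \<open>q\<close> on a causal chain, since
  the diameters then sum to a geometric series. For \<open>q < 2\<close> all tetrahedra of that level are counted.
  For \<open>q \<ge> 2\<close> let \<open>X\<close> be the ancestor of an event in the mesh \<open>3 * q\<close>, and \<open>Y\<close> that in the mesh
  \<open>3 * (q - 1)\<close>. Exactly one vertex of \<open>X\<close> is old, i.e. a vertex of the mesh of \<open>Y\<close>, and every mark
  on a face of \<open>X\<close> contains this vertex or the midpoint of the refinement edge of \<open>Y\<close>. The edge
  bisected by the events may stay constant at first. Once it has changed it contains such a midpoint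
  or an old vertex. As long as it contains no old vertex, all \<open>Y\<close> share one vertex of the mesh
  \<open>3 * (q - 2)\<close>; an old vertex, once contained, is kept. So the events of one level lie in three vertex
  stars of the mesh \<open>3 * (q - 1)\<close>.
\<close>

section \<open>Barycentric coordinates and bisection\<close>

text \<open>Coordinates are functions on all of space, zero outside the tetrahedron, so that those
  with respect to different tetrahedra can be compared; two tetrahedra fit together if every common
  point has the same coordinates in both. Bisection acts on coordinates by a map that depends only
  on the bisected edge, and which edge is cut next is dictated by the old vertices carrying weight.
  Hence three generations act as one map, common to all tetrahedra of a mesh, and conformity passes
  to the next level with little regard to types: only the coplanarity of the marks is ever
  distinguished. The obstacle to counting is that a chain may bisect many edges on one level; its
  position is therefore controlled by vertices that it cannot leave. Constants: the three
  generations of a level give 8 + 16 + 32 = 56 descendants per tetrahedron of the next coarser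
  uniform mesh, so three stars give 168 \<nu> \<le> 630 \<nu>, and levels 0 and 1 have at most 56
  #T0 \<le> 448 #T0 tetrahedra each. The factor 4 is 2 from the geometric series times 2 because
  \<open>T\<close> may be one level finer than the bisected tetrahedron.\<close>

definition barycentric :: "point set \<Rightarrow> point \<Rightarrow> (point \<Rightarrow> real) \<Rightarrow> bool" where
  "barycentric V x l \<longleftrightarrow>
     (\<forall>y. 0 \<le> l y) \<and> (\<forall>y. y \<notin> V \<longrightarrow> l y = 0) \<and> sum l V = 1 \<and> (\<Sum>y\<in>V. l y *\<^sub>R y) = x"

text \<open>
  The change of coordinates under bisection of \<open>e\<close>. It treats the two endpoints of \<open>e\<close> alike, hence it is
  the same map for both children.
\<close>

definition cut :: "point set \<Rightarrow> (point \<Rightarrow> real) \<Rightarrow> point \<Rightarrow> real" where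
  "cut e l = (\<lambda>y. l y - (if y \<in> e then Min (l ` e) else 0)
                     + (if y = mid e then 2 * Min (l ` e) else 0))"

lemma barycentric_ge0: "barycentric V x l \<Longrightarrow> 0 \<le> l y"
  by (simp add: barycentric_def)

lemma barycentric_outside: "barycentric V x l \<Longrightarrow> y \<notin> V \<Longrightarrow> l y = 0"
  by (simp add: barycentric_def)

lemma hull_iff_barycentric:
  assumes "finite V"
  shows "x \<in> convex hull V \<longleftrightarrow> (\<exists>l. barycentric V x l)"
proof
  assume "x \<in> convex hull V"
  then obtain u where u: "\<forall>y\<in>V. 0 \<le> u y" "sum u V = 1" "(\<Sum>y\<in>V. u y *\<^sub>R y) = x"
    using assms by (auto simp: convex_hull_finite)
  let ?l = "\<lambda>y. if y \<in> V then u y else 0"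
  have "sum ?l V = sum u V" "(\<Sum>y\<in>V. ?l y *\<^sub>R y) = (\<Sum>y\<in>V. u y *\<^sub>R y)"
    by (auto intro: sum.cong)
  then have "barycentric V x ?l"
    using u by (auto simp: barycentric_def)
  then show "\<exists>l. barycentric V x l" by blast
next
  assume "\<exists>l. barycentric V x l"
  then show "x \<in> convex hull V"
    using assms by (auto simp: convex_hull_finite barycentric_def)
qed

lemma barycentric_unique:
  assumes "\<not> affine_dependent V" "finite V" "barycentric V x l" "barycentric V x l'"
  shows "l = l'"
proof
  fix y
  have "sum (\<lambda>y. l y - l' y) V = 0" "(\<Sum>y\<in>V. (l y - l' y) *\<^sub>R y) = 0"
    using assms(3,4) by (simp_all add: barycentric_def sum_subtractf scaleR_left_diff_distrib)
  then have "\<forall>y\<in>V. l y - l' y = 0"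
    using assms(1,2) unfolding affine_dependent_explicit_finite[OF assms(2)] by blast
  then show "l y = l' y"
    using assms(3,4) by (cases "y \<in> V") (auto simp: barycentric_def)
qed

lemma barycentric_mono:
  assumes "barycentric S x l" "S \<subseteq> V" "finite V"
  shows "barycentric V x l"
proof -
  have z: "\<And>y. y \<notin> S \<Longrightarrow> l y = 0"
    using assms(1) by (simp add: barycentric_def)
  have "sum l V = sum l S" "(\<Sum>y\<in>V. l y *\<^sub>R y) = (\<Sum>y\<in>S. l y *\<^sub>R y)"
    using assms(2,3) z by (auto intro!: sum.mono_neutral_right)
  then show ?thesis
    using assms(1,2) unfolding barycentric_def by auto
qed

lemma barycentric_vertex:
  assumes "v \<in> V" "finite V"
  shows "barycentric V v (\<lambda>y. if y = v then 1 else 0)"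
  by (rule barycentric_mono[of "{v}"]) (use assms in \<open>auto simp: barycentric_def\<close>)

lemma barycentric_mid:
  assumes "g \<subseteq> V" "card g = 2" "finite V"
  shows "barycentric V (mid g) (\<lambda>y. if y \<in> g then 1 / 2 else 0)"
proof (rule barycentric_mono[of g])
  obtain a b where g: "g = {a, b}" "a \<noteq> b"
    using assms(2) card_2_iff by metis
  let ?l = "\<lambda>y. if y \<in> g then 1 / 2 else (0::real)"
  have "sum ?l g = 1" "(\<Sum>y\<in>g. ?l y *\<^sub>R y) = mid g"
    using g(2) unfolding g(1) mid_def by (simp_all add: scaleR_add_right)
  then show "barycentric g (mid g) ?l"
    unfolding barycentric_def by simp
qed (use assms in auto)

section \<open>Nondegenerate tetrahedra and their halves\<close>

lemma tetrahedron_finite: "tetrahedron V \<Longrightarrow> finite V"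
  unfolding tetrahedron_def by (metis card.infinite zero_neq_numeral)

lemma tetrahedron_card: "tetrahedron V \<Longrightarrow> card V = 4"
  by (simp add: tetrahedron_def)

lemma tetrahedron_unique:
  "tetrahedron V \<Longrightarrow> barycentric V x l \<Longrightarrow> barycentric V x l' \<Longrightarrow> l = l'"
  using barycentric_unique tetrahedron_finite by (auto simp: tetrahedron_def)

lemma mid_not_vertex:
  assumes "tetrahedron V" "g \<subseteq> V" "card g = 2"
  shows "mid g \<notin> V"
proof
  assume "mid g \<in> V"
  then have "(\<lambda>y. if y = mid g then 1 else 0) = (\<lambda>y. if y \<in> g then 1 / 2 else (0::real))"
    using assms tetrahedron_finite
    by (intro tetrahedron_unique[OF assms(1) barycentric_vertex barycentric_mid])
  from fun_cong[OF this, of "mid g"] show False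
    by (auto split: if_splits)
qed

lemma tetrahedron_edge_split:
  assumes "tetrahedron V" "{a, b} \<subseteq> V" "a \<noteq> b"
  obtains p r where "V = {a, b, p, r}" "distinct [a, b, p, r]"
proof -
  have "card (V - {a, b}) = 2"
    using assms by (simp add: card_Diff_subset tetrahedron_card)
  then obtain p r where "V - {a, b} = {p, r}" "p \<noteq> r"
    by (auto simp: card_2_iff)
  then have "V = {a, b, p, r}" "distinct [a, b, p, r]"
    using assms by auto
  then show thesis using that by blast
qed

text \<open>An affine dependency among the vertices of the half pulls back to one among those of
  \<open>V\<close> once the weight of the midpoint is split evenly between \<open>a\<close> and
  \<open>b\<close>.\<close>

lemma tetrahedron_half:
  assumes "tetrahedron V" "{a, b} \<subseteq> V" "a \<noteq> b"
  shows "tetrahedron (insert (mid {a, b}) (V - {b}))"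
proof -
  obtain p r where V: "V = {a, b, p, r}" and d: "distinct [a, b, p, r]"
    using tetrahedron_edge_split[OF assms] .
  let ?m = "mid {a, b}"
  have m: "?m \<notin> V"
    using mid_not_vertex assms by simp
  have W: "insert ?m (V - {b}) = {a, ?m, p, r}"
    using V d by auto
  have mm: "?m = (1/2) *\<^sub>R a + (1/2) *\<^sub>R b"
    using assms(3) by (simp add: mid_def scaleR_add_right)
  have d': "distinct [a, ?m, p, r]"
    using m d V by auto
  have "\<not> affine_dependent {a, ?m, p, r}"
  proof
    assume "affine_dependent {a, ?m, p, r}"
    then obtain U where U: "sum U {a, ?m, p, r} = 0" "\<exists>v\<in>{a, ?m, p, r}. U v \<noteq> 0"
        "(\<Sum>v\<in>{a, ?m, p, r}. U v *\<^sub>R v) = 0"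
      unfolding affine_dependent_explicit_finite[of "{a, ?m, p, r}", simplified] by auto
    define l where "l y = (if y = a then U a + U ?m / 2 else if y = b then U ?m / 2 else U y)" for y
    have l: "l a = U a + U ?m / 2" "l b = U ?m / 2" "l p = U p" "l r = U r"
      using d by (auto simp: l_def)
    have 1: "sum l V = 0"
      using U(1) d d' l by (simp add: V)
    have "(\<Sum>v\<in>V. l v *\<^sub>R v) = U a *\<^sub>R a + U ?m *\<^sub>R ?m + U p *\<^sub>R p + U r *\<^sub>R r"
      using d l by (simp add: V mm algebra_simps)
    also have "\<dots> = 0"
      using U(3) d' by (simp add: algebra_simps)
    finally have 2: "(\<Sum>v\<in>V. l v *\<^sub>R v) = 0" .
    have "\<forall>v\<in>V. l v = 0"
      using assms(1) 1 2 affine_dependent_explicit_finite[OF tetrahedron_finite[OF assms(1)]]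
      unfolding tetrahedron_def by blast
    then have "U a + U ?m / 2 = 0" "U ?m / 2 = 0" "U p = 0" "U r = 0"
      using l V by auto
    then show False using U(2) by auto
  qed
  moreover have "card {a, ?m, p, r} = 4"
    using d' by simp
  ultimately show ?thesis
    by (simp add: tetrahedron_def W)
qed

text \<open>Equal weights at \<open>a\<close> and \<open>b\<close> can be traded for their double at
  the midpoint. In the half that keeps \<open>a\<close>, the weight of \<open>a\<close> dominates
  and \<open>b\<close> must lose all of its weight, so what is traded is \<open>l b\<close>, the
  minimum in \<open>cut\<close>.\<close>

lemma barycentric_half_iff:
  assumes "tetrahedron V" "{a, b} \<subseteq> V" "a \<noteq> b"
  shows "barycentric (insert (mid {a, b}) (V - {b})) x l' \<longleftrightarrow>
         (\<exists>l. barycentric V x l \<and> l b \<le> l a \<and> l' = cut {a, b} l)"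
proof -
  obtain p r where V: "V = {a, b, p, r}" and d: "distinct [a, b, p, r]"
    using tetrahedron_edge_split[OF assms] .
  let ?m = "mid {a, b}"
  have m: "?m \<notin> V"
    using mid_not_vertex assms by simp
  have W: "insert ?m (V - {b}) = {a, ?m, p, r}"
    using V d by auto
  have mm: "?m = (1/2) *\<^sub>R a + (1/2) *\<^sub>R b"
    using assms(3) by (simp add: mid_def scaleR_add_right)
  have d': "distinct [a, ?m, p, r]" "?m \<noteq> b"
    using m d V by auto
  show ?thesis unfolding W
  proof
    assume L: "barycentric {a, ?m, p, r} x l'"
    \<comment> \<open>The inverse of \<open>cut\<close>: the weight of the midpoint returns in
      halves to \<open>a\<close> and \<open>b\<close>.\<close>
    define l where "l y = (if y = a then l' a + l' ?m / 2 else if y = b then l' ?m / 2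
      else if y = ?m then 0 else l' y)" for y
    have l: "l a = l' a + l' ?m / 2" "l b = l' ?m / 2" "l p = l' p" "l r = l' r" "l ?m = 0"
      using d d' by (auto simp: l_def)
    have lb: "l' b = 0"
      using L d d' by (auto simp: barycentric_def)
    have "sum l V = 1"
      using L d d' l by (simp add: V barycentric_def)
    moreover have "(\<Sum>v\<in>V. l v *\<^sub>R v) = x"
    proof -
      have "(\<Sum>v\<in>V. l v *\<^sub>R v) = l' a *\<^sub>R a + l' ?m *\<^sub>R ?m + l' p *\<^sub>R p + l' r *\<^sub>R r"
        using d l by (simp add: V mm algebra_simps)
      then show ?thesis using L d' by (simp add: barycentric_def algebra_simps)
    qed
    moreover have "0 \<le> l y" for y
      using barycentric_ge0[OF L] by (auto simp: l_def)
    moreover have "l y = 0" if "y \<notin> V" for y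
      using that barycentric_outside[OF L, of y] by (auto simp: l_def V)
    ultimately have B: "barycentric V x l"
      by (simp add: barycentric_def)
    have mi: "Min (l ` {a, b}) = l' ?m / 2"
      using l barycentric_ge0[OF L, of a] by simp
    have "l' y = cut {a, b} l y" for y
      unfolding cut_def mi using l d d' lb by (auto simp: l_def)
    then show "\<exists>l. barycentric V x l \<and> l b \<le> l a \<and> l' = cut {a, b} l"
      using B l barycentric_ge0[OF L, of a] by (intro exI[of _ l]) auto
  next
    assume "\<exists>l. barycentric V x l \<and> l b \<le> l a \<and> l' = cut {a, b} l"
    then obtain l where L: "barycentric V x l" and le: "l b \<le> l a" and l': "l' = cut {a, b} l"
      by blast
    have lm: "l ?m = 0"
      using barycentric_outside[OF L m] .
    have e: "l' a = l a - l b" "l' ?m = 2 * l b" "l' b = 0" "l' p = l p" "l' r = l r"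
      using le d d' lm by (auto simp: l' cut_def min_def)
    have "sum l' {a, ?m, p, r} = 1"
      using L d d' e by (simp add: barycentric_def V)
    moreover have "(\<Sum>v\<in>{a, ?m, p, r}. l' v *\<^sub>R v) = x"
    proof -
      have "(\<Sum>v\<in>{a, ?m, p, r}. l' v *\<^sub>R v) = l' a *\<^sub>R a + l' ?m *\<^sub>R ?m + l' p *\<^sub>R p + l' r *\<^sub>R r"
        using d' by (simp add: algebra_simps)
      also have "l' ?m *\<^sub>R ?m = l b *\<^sub>R a + l b *\<^sub>R b"
        unfolding e(2) by (simp add: mm algebra_simps)
      also have "l' a *\<^sub>R a + (l b *\<^sub>R a + l b *\<^sub>R b) + l' p *\<^sub>R p + l' r *\<^sub>R r
          = l a *\<^sub>R a + l b *\<^sub>R b + l p *\<^sub>R p + l r *\<^sub>R r"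
        unfolding e by (simp add: algebra_simps)
      also have "\<dots> = x"
        using L d by (simp add: barycentric_def V algebra_simps)
      finally show ?thesis .
    qed
    moreover have other: "l' y = l y" if "y \<noteq> a" "y \<noteq> b" "y \<noteq> ?m" for y
      using that unfolding l' cut_def by simp
    have "0 \<le> l' y" for y
      using barycentric_ge0[OF L] le other[of y] e
      by (cases "y = a"; cases "y = b"; cases "y = ?m") simp_all
    moreover have "l' y = 0" if "y \<notin> {a, ?m, p, r}" for y
      using that barycentric_outside[OF L, of y] other[of y] e(3) V by (cases "y = b") auto
    ultimately show "barycentric {a, ?m, p, r} x l'"
      by (simp add: barycentric_def)
  qed
qed

section \<open>Three generations below an unflagged tetrahedron\<close>

lemma card_2_other:
  assumes "card e = 2" "a \<in> e"
  obtains b where "e = {a, b}" "a \<noteq> b"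
  using assms by (metis card_2_iff doubleton_eq_iff insertE singletonD)

lemma faces_of_4:
  assumes "distinct [a, b, c, d]"
  shows "faces_of {a, b, c, d} = {{a, b, c}, {a, b, d}, {a, c, d}, {b, c, d}}" (is "_ = ?R")
proof
  show "?R \<subseteq> faces_of {a, b, c, d}"
    using assms by (auto simp: faces_of_def)
  show "faces_of {a, b, c, d} \<subseteq> ?R"
  proof
    fix F assume "F \<in> faces_of {a, b, c, d}"
    then have F: "F \<subseteq> {a, b, c, d}" "card F = 3"
      by (auto simp: faces_of_def)
    then have "card ({a, b, c, d} - F) = 1"
      using assms by (subst card_Diff_subset) (auto intro: finite_subset)
    then obtain x where x: "{a, b, c, d} - F = {x}"
      by (auto simp: card_1_singleton_iff)
    then have "F = {a, b, c, d} - {x}" "x \<in> {a, b, c, d}"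
      using F by auto
    then show "F \<in> ?R"
      using assms by auto
  qed
qed

lemma edges_of_3:
  assumes "distinct [a, b, c]"
  shows "edges_of {a, b, c} = {{a, b}, {a, c}, {b, c}}" (is "_ = ?R")
proof
  show "?R \<subseteq> edges_of {a, b, c}"
    using assms by (auto simp: edges_of_def)
  show "edges_of {a, b, c} \<subseteq> ?R"
  proof
    fix F assume "F \<in> edges_of {a, b, c}"
    then have F: "F \<subseteq> {a, b, c}" "card F = 2"
      by (auto simp: edges_of_def)
    then have "card ({a, b, c} - F) = 1"
      using assms by (subst card_Diff_subset) (auto intro: finite_subset)
    then obtain x where x: "{a, b, c} - F = {x}"
      by (auto simp: card_1_singleton_iff)
    then have "F = {a, b, c} - {x}" "x \<in> {a, b, c}"
      using F by auto
    then show "F \<in> ?R"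
      using assms by auto
  qed
qed

lemma tetrahedron_not_coplanar:
  assumes "tetrahedron V" "V \<subseteq> S"
  shows "\<not> coplanar S"
proof
  assume "coplanar S"
  then obtain u v w where "S \<subseteq> affine hull {u, v, w}"
    by (auto simp: coplanar_def)
  then have "aff_dim V \<le> aff_dim {u, v, w}"
    using assms(2) by (metis aff_dim_affine_hull aff_dim_subset order_trans)
  also have "\<dots> \<le> int (card {u, v, w}) - 1"
    by (rule aff_dim_le_card) simp
  also have "\<dots> \<le> 2"
    using card_insert_le_m1[of 3 "{v, w}" u] card_insert_le_m1[of 2 "{w}" v] by simp
  finally show False
    using assms(1) aff_dim_affine_independent[of V] by (simp add: tetrahedron_def)
qed

lemma child_explicit:
  assumes T: "tetrahedron (verts K)" and V: "verts K = {a, b, p, r}" and d: "distinct [a, b, p, r]"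
    and e: "refedge K = {a, b}" and m: "m = mid {a, b}"
  shows "verts (child K a) = {a, m, p, r}"
    and "distinct [a, m, p, r]"
    and "tetrahedron {a, m, p, r}"
    and "refedge (child K a) = mark K {a, p, r}"
    and "flag (child K a) = type_Pu K"
    and "mark (child K a) {a, p, r} = mark K {a, p, r}"
    and "mark (child K a) {m, p, r} = (if type_Pf K then {m, common_endpoint K} else {p, r})"
    and "mark (child K a) {a, m, p} = {a, p}"
    and "mark (child K a) {a, m, r} = {a, r}"
proof -
  have mV: "m \<notin> {a, b, p, r}"
    using mid_not_vertex[OF T, of "{a, b}"] V d m by simp
  then show d': "distinct [a, m, p, r]"
    using d by auto
  have inh: "inherited_face K a = {a, p, r}"
    using V d e by (auto simp: inherited_face_def)
  have new: "new_face K = {m, p, r}"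
    using V d e m by (auto simp: new_face_def)
  have "insert m {a, p, r} = insert m ({a, b, p, r} - {b})"
    using d by auto
  then show "tetrahedron {a, m, p, r}"
    using tetrahedron_half[of "verts K" a b] T V d m by (simp add: insert_commute)
  have W: "insert m {a, p, r} = {a, m, p, r}"
    by auto
  show v: "verts (child K a) = {a, m, p, r}"
    by (simp add: child_def Let_def inh e m[symmetric] W)
  show "refedge (child K a) = mark K {a, p, r}" "flag (child K a) = type_Pu K"
    by (simp_all add: child_def Let_def inh)
  have mk: "mark (child K a) F = (if F \<notin> faces_of {a, m, p, r} then {}
                    else if F = {a, p, r} then mark K F
                    else if F = {m, p, r} then
                      (if type_Pf K then {m, common_endpoint K} else {p, r})
                    else F - {m})" for F
  proof -
    have "verts K - {a, b} = {p, r}"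
      using V d by auto
    then show ?thesis
      by (simp add: child_def Let_def inh new e m[symmetric] W)
  qed
  have ne: "{m, p, r} \<noteq> {a, p, r}" "{a, m, p} \<noteq> {a, p, r}" "{a, m, r} \<noteq> {a, p, r}"
    "{a, m, p} \<noteq> {m, p, r}" "{a, m, r} \<noteq> {m, p, r}"
    using d' by (auto simp: set_eq_iff)
  have fc: "{a, p, r} \<in> faces_of {a, m, p, r}" "{m, p, r} \<in> faces_of {a, m, p, r}"
     "{a, m, p} \<in> faces_of {a, m, p, r}" "{a, m, r} \<in> faces_of {a, m, p, r}"
    using d' by (simp_all add: faces_of_4)
  have "{a, m, p} - {m} = {a, p}" "{a, m, r} - {m} = {a, r}"
    using d' by auto
  then show "mark (child K a) {a, p, r} = mark K {a, p, r}"
    "mark (child K a) {m, p, r} = (if type_Pf K then {m, common_endpoint K} else {p, r})"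
    "mark (child K a) {a, m, p} = {a, p}" "mark (child K a) {a, m, r} = {a, r}"
    using ne fc by (simp_all add: mk)
qed

text \<open>The invariant of the meshes \<open>uniform T0 (3 * q)\<close>. Three bisections lead
  back to it; of the two generations in between exactly one is flagged, depending on whether the
  marks are coplanar.\<close>

definition plain :: "marked_tet \<Rightarrow> bool" where
  "plain K \<longleftrightarrow> tetrahedron (verts K) \<and> refedge K \<in> edges K \<and>
     (\<forall>F\<in>faces K. mark K F \<in> edges_of F) \<and>
     (\<forall>F\<in>faces K. refedge K \<subseteq> F \<longrightarrow> mark K F = refedge K) \<and> \<not> flag K"

lemma marked_tetrahedron_plain: "marked_tetrahedron K \<Longrightarrow> \<not> flag K \<Longrightarrow> plain K"
  by (simp add: marked_tetrahedron_def plain_def)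

text \<open>
  In the following three predicates \<open>m\<close>, \<open>n\<close>, \<open>z\<close> are the midpoints created by the first, second and third
  bisection below \<open>Y\<close>, the face \<open>{w, w', t}\<close> of \<open>Y\<close> is the inherited face of the child with refinement
  edge \<open>{w, w'}\<close>, and \<open>c\<close> is the only vertex of \<open>Y\<close> left in the third generation.
\<close>

definition first_gen where
  "first_gen Y J w w' t m \<longleftrightarrow>
     verts J = {w, w', t, m} \<and> distinct [w, w', t, m] \<and> tetrahedron {w, w', t, m} \<and>
     refedge J = {w, w'} \<and> mark J {w, w', t} = {w, w'} \<and> mark J {w, w', m} = {w, w'} \<and>
     mark J {w, t, m} = {w, t} \<and> mark J {w', t, m} = {w', t} \<and>
     flag J = coplanar_marks Y \<and> mid (refedge Y) = m \<and>
     {w, w', t} \<in> faces Y \<and> mark Y {w, w', t} = {w, w'} \<and> \<not> refedge Y \<subseteq> {w, w', t}"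

lemma first_gen_swap: "first_gen Y J w w' t m \<Longrightarrow> first_gen Y J w' w t m"
  unfolding first_gen_def by (auto simp: insert_commute)

text \<open>The mark of the inherited face is one of its three edges, and the vertices are named
  after it. This absorbs all types, except that the coplanarity of the marks of \<open>Y\<close>
  survives as the flag of \<open>J\<close>.\<close>

lemma first_gen_exists:
  assumes "plain Y" "J \<in> children Y"
  obtains w w' t m where "first_gen Y J w w' t m"
proof -
  have T: "tetrahedron (verts Y)" and ed: "refedge Y \<in> edges Y"
    and mk: "\<And>F. F \<in> faces Y \<Longrightarrow> mark Y F \<in> edges_of F" and fl: "\<not> flag Y"
    using assms(1) by (auto simp: plain_def)
  obtain a where a: "a \<in> refedge Y" "J = child Y a"
    using assms(2) by (auto simp: children_def)
  have "card (refedge Y) = 2" and sub: "refedge Y \<subseteq> verts Y"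
    using ed by (auto simp: edges_of_def)
  then obtain b where b: "refedge Y = {a, b}" "a \<noteq> b"
    using a(1) card_2_other by metis
  obtain p r where V: "verts Y = {a, b, p, r}" and d: "distinct [a, b, p, r]"
    using tetrahedron_edge_split[OF T, of a b] sub b by auto
  let ?m = "mid (refedge Y)"
  have m: "?m = mid {a, b}"
    using b by simp
  note C = child_explicit[OF T V d b(1) m, folded a(2)]
  have nPf: "\<not> type_Pf Y"
    using fl by (simp add: type_Pf_def)
  have fc: "{a, p, r} \<in> faces Y"
    using d by (simp add: V faces_of_4)
  have nsub: "\<not> refedge Y \<subseteq> {a, p, r}"
    using b d by auto
  have flJ: "flag J = coplanar_marks Y"
    using C(5) fl by (simp add: type_Pu_def)
  have "mark Y {a, p, r} \<in> {{a, p}, {a, r}, {p, r}}"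
    using mk[OF fc] d by (simp add: edges_of_3)
  moreover have "first_gen Y J a p r ?m" if "mark Y {a, p, r} = {a, p}"
    using C that nPf flJ fc nsub unfolding first_gen_def
    by (auto simp: insert_commute)
  moreover have "first_gen Y J a r p ?m" if "mark Y {a, p, r} = {a, r}"
    using C that nPf flJ fc nsub unfolding first_gen_def
    by (auto simp: insert_commute)
  moreover have "first_gen Y J p r a ?m" if "mark Y {a, p, r} = {p, r}"
    using C that nPf flJ fc nsub unfolding first_gen_def
    by (auto simp: insert_commute)
  ultimately show thesis
    using that by blast
qed

lemma coplanar_marks_face:
  assumes "\<And>F. F \<in> faces K \<Longrightarrow> mark K F \<subseteq> {a, b, c}"
  shows "coplanar_marks K"
  unfolding coplanar_marks_def coplanar_def
proof (intro exI)
  show "(\<Union>F\<in>faces K. convex hull mark K F) \<subseteq> affine hull {a, b, c}"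
  proof (rule UN_least)
    fix F assume "F \<in> faces K"
    then show "convex hull mark K F \<subseteq> affine hull {a, b, c}"
      by (intro order_trans[OF convex_hull_subset_affine_hull] hull_mono assms)
  qed
qed

text \<open>No mark contains the new vertex \<open>m\<close>, so all four lie in the plane of the
  inherited face. Hence \<open>J\<close> has type \<open>P_f\<close> or \<open>P_u\<close>,
  according to whether the marks of \<open>Y\<close> are coplanar.\<close>

lemma first_gen_coplanar:
  assumes "first_gen Y J w w' t m"
  shows "coplanar_marks J"
proof (rule coplanar_marks_face)
  fix F assume "F \<in> faces J"
  moreover have "verts J = {w, w', t, m}" "distinct [w, w', t, m]"
    using assms by (simp_all add: first_gen_def)
  ultimately have "F \<in> {{w, w', t}, {w, w', m}, {w, t, m}, {w', t, m}}"
    using faces_of_4 by metis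
  moreover have "mark J {w, w', t} = {w, w'}" "mark J {w, w', m} = {w, w'}"
      "mark J {w, t, m} = {w, t}" "mark J {w', t, m} = {w', t}"
    using assms by (simp_all add: first_gen_def)
  ultimately show "mark J F \<subseteq> {w, w', t}"
    by auto
qed

lemma first_gen_common_endpoint:
  assumes "first_gen Y J w w' t m"
  shows "common_endpoint J = t"
proof -
  have S: "verts J = {w, w', t, m}" "distinct [w, w', t, m]" "refedge J = {w, w'}"
     "mark J {w, t, m} = {w, t}" "mark J {w', t, m} = {w', t}"
    using assms by (simp_all add: first_gen_def)
  have *: "verts J - refedge J = {t, m}" "inherited_face J w = {w, t, m}"
     "inherited_face J w' = {w', t, m}"
    using S by (auto simp: inherited_face_def)
  show ?thesis
    unfolding common_endpoint_def *(1)
  proof (rule the_equality)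
    show "t \<in> {t, m} \<and> (\<forall>v\<in>refedge J. t \<in> mark J (inherited_face J v))"
      using S * by auto
  next
    fix x assume "x \<in> {t, m} \<and> (\<forall>v\<in>refedge J. x \<in> mark J (inherited_face J v))"
    then have "x \<in> {t, m}" "x \<in> mark J {w, t, m}"
      using S * by auto
    then show "x = t"
      using S by auto
  qed
qed

definition second_gen where
  "second_gen Y J2 w t m n \<longleftrightarrow>
     verts J2 = {w, t, m, n} \<and> distinct [w, t, m, n] \<and> tetrahedron {w, t, m, n} \<and>
     refedge J2 = {w, t} \<and> mark J2 {w, t, m} = {w, t} \<and> mark J2 {w, t, n} = {w, t} \<and>
     mark J2 {w, m, n} = {w, m} \<and>
     mark J2 {t, m, n} = (if coplanar_marks Y then {n, t} else {t, m}) \<and>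
     flag J2 = (\<not> coplanar_marks Y) \<and> mid (refedge Y) = m \<and>
     (\<exists>w'. mid {w, w'} = n \<and> distinct [w, w', t] \<and> {w, w', t} \<in> faces Y \<and>
       mark Y {w, w', t} = {w, w'} \<and> \<not> refedge Y \<subseteq> {w, w', t})"

lemma second_gen_exists:
  assumes "first_gen Y J u u' t m" "J2 \<in> children J"
  obtains w n where "second_gen Y J2 w t m n" "w \<in> {u, u'}"
proof -
  have "refedge J = {u, u'}"
    using assms(1) by (simp add: first_gen_def)
  then obtain w where w: "w \<in> {u, u'}" "J2 = child J w"
    using assms(2) by (auto simp: children_def)
  obtain w' where F: "first_gen Y J w w' t m"
    using w(1) assms(1) first_gen_swap[OF assms(1)] by auto
  have T: "tetrahedron (verts J)" and V: "verts J = {w, w', t, m}" and d: "distinct [w, w', t, m]"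
    and e: "refedge J = {w, w'}"
    using F by (auto simp: first_gen_def)
  note C = child_explicit[OF T V d e refl, folded w(2)]
  have Pf: "type_Pf J = coplanar_marks Y" "type_Pu J = (\<not> coplanar_marks Y)"
    using first_gen_coplanar[OF F] F by (auto simp: type_Pf_def type_Pu_def first_gen_def)
  have "second_gen Y J2 w t m (mid {w, w'})"
    unfolding second_gen_def
  proof (intro conjI exI[of _ w'])
    show "verts J2 = {w, t, m, mid {w, w'}}" "tetrahedron {w, t, m, mid {w, w'}}"
      using C(1,3) by (auto simp: insert_commute)
    show "distinct [w, t, m, mid {w, w'}]"
      using C(2) by auto
    show "mark J2 {t, m, mid {w, w'}} = (if coplanar_marks Y then {mid {w, w'}, t} else {t, m})"
      using C(7) by (simp add: Pf first_gen_common_endpoint[OF F] insert_commute)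
    show "refedge J2 = {w, t}" "mark J2 {w, t, m} = {w, t}" "mark J2 {w, t, mid {w, w'}} = {w, t}"
     "mark J2 {w, m, mid {w, w'}} = {w, m}"
      using C(4,6,8,9) F by (simp_all add: first_gen_def insert_commute)
    show "flag J2 = (\<not> coplanar_marks Y)"
      using C(5) Pf by simp
  qed (use F in \<open>auto simp: first_gen_def\<close>)
  then show thesis using that w(1) by blast
qed

text \<open>Besides \<open>{w, t}\<close> and \<open>{w, m}\<close> there is either the mark
  \<open>{t, m}\<close>, which stays in the plane of \<open>w\<close>, \<open>t\<close>,
  \<open>m\<close>, or \<open>{n, t}\<close>, which reaches the fourth vertex. Together with the
  flag this excludes type \<open>P_u\<close> in the second generation.\<close>

lemma second_gen_coplanar:
  assumes "second_gen Y J w t m n"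
  shows "coplanar_marks J \<longleftrightarrow> \<not> coplanar_marks Y"
proof
  have fc: "faces J = {{w, t, m}, {w, t, n}, {w, m, n}, {t, m, n}}"
  proof -
    have "verts J = {w, t, m, n}" "distinct [w, t, m, n]"
      using assms by (simp_all add: second_gen_def)
    then show ?thesis
      using faces_of_4 by metis
  qed
  have mk: "mark J {w, t, m} = {w, t}" "mark J {w, t, n} = {w, t}" "mark J {w, m, n} = {w, m}"
     "mark J {t, m, n} = (if coplanar_marks Y then {n, t} else {t, m})"
    using assms by (simp_all add: second_gen_def)
  show "coplanar_marks J" if "\<not> coplanar_marks Y"
  proof (rule coplanar_marks_face)
    fix F assume "F \<in> faces J"
    then show "mark J F \<subseteq> {w, t, m}"
      using mk that by (auto simp: fc)
  qed
  show "\<not> coplanar_marks Y" if "coplanar_marks J"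
  proof
    assume c: "coplanar_marks Y"
    have sub: "mark J F \<subseteq> (\<Union>F\<in>faces J. convex hull mark J F)" if "F \<in> faces J" for F
      using that hull_subset[of "mark J F" convex] by blast
    have "{w, t} \<subseteq> (\<Union>F\<in>faces J. convex hull mark J F)"
      using sub[of "{w, t, m}"] mk(1) fc by simp
    moreover have "{w, m} \<subseteq> (\<Union>F\<in>faces J. convex hull mark J F)"
      using sub[of "{w, m, n}"] mk(3) fc by simp
    moreover have "{n, t} \<subseteq> (\<Union>F\<in>faces J. convex hull mark J F)"
      using sub[of "{t, m, n}"] mk(4) c fc by simp
    moreover have "verts J = {w, t, m, n}" "tetrahedron (verts J)"
      using assms by (simp_all add: second_gen_def)
    ultimately show False
      using tetrahedron_not_coplanar[of "verts J" "\<Union>F\<in>faces J. convex hull mark J F"] that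
      by (simp add: coplanar_marks_def)
  qed
qed

lemma second_gen_common_endpoint:
  assumes "second_gen Y J w t m n" "\<not> coplanar_marks Y"
  shows "common_endpoint J = m"
proof -
  have S: "verts J = {w, t, m, n}" "distinct [w, t, m, n]" "refedge J = {w, t}"
     "mark J {w, m, n} = {w, m}" "mark J {t, m, n} = {t, m}"
    using assms by (simp_all add: second_gen_def)
  have *: "verts J - refedge J = {m, n}" "inherited_face J w = {w, m, n}"
     "inherited_face J t = {t, m, n}"
    using S by (auto simp: inherited_face_def)
  show ?thesis
    unfolding common_endpoint_def *(1)
  proof (rule the_equality)
    show "m \<in> {m, n} \<and> (\<forall>v\<in>refedge J. m \<in> mark J (inherited_face J v))"
      using S * by auto
  next
    fix x assume "x \<in> {m, n} \<and> (\<forall>v\<in>refedge J. x \<in> mark J (inherited_face J v))"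
    then have "x \<in> {m, n}" "x \<in> mark J {w, m, n}"
      using S * by auto
    then show "x = m"
      using S by auto
  qed
qed

definition third_gen where
  "third_gen Y X w w' t c m n z \<longleftrightarrow>
     verts X = {c, z, m, n} \<and> distinct [c, z, m, n] \<and> tetrahedron {c, z, m, n} \<and>
     c \<in> {w, t} \<and>
     refedge X = (if c = w then {c, m} else if coplanar_marks Y then {c, n} else {c, m}) \<and>
     mark X {c, m, n} = refedge X \<and> mark X {c, z, m} = {c, m} \<and> mark X {c, z, n} = {c, n} \<and>
     mark X {z, m, n} = (if coplanar_marks Y then {m, n} else {z, m}) \<and> \<not> flag X \<and>
     mid (refedge Y) = m \<and> mid {w, w'} = n \<and> mid {w, t} = z \<and>
     distinct [w, w', t] \<and> {w, w', t} \<in> faces Y \<and>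
     mark Y {w, w', t} = {w, w'} \<and> \<not> refedge Y \<subseteq> {w, w', t}"

text \<open>As \<open>J\<close> is not of type \<open>P_u\<close>, the flag of \<open>X\<close> is
  unset again and the cycle of three generations closes. If \<open>J\<close> has type
  \<open>P_f\<close>, then \<open>m\<close> is the common endpoint and the new face is marked by
  \<open>{z, m}\<close>, otherwise by \<open>{m, n}\<close>.\<close>

lemma third_gen_exists:
  assumes S: "second_gen Y J w t m n" and "X \<in> children J"
  obtains w' c z where "third_gen Y X w w' t c m n z"
proof -
  let ?z = "mid {w, t}"
  obtain w' where w': "mid {w, w'} = n" "distinct [w, w', t]" "{w, w', t} \<in> faces Y"
    "mark Y {w, w', t} = {w, w'}" "\<not> refedge Y \<subseteq> {w, w', t}"
    using S by (auto simp: second_gen_def)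
  have T: "tetrahedron (verts J)" and V: "verts J = {w, t, m, n}" and d: "distinct [w, t, m, n]"
    and e: "refedge J = {w, t}"
    using S by (auto simp: second_gen_def)
  have Pf: "type_Pf J = (\<not> coplanar_marks Y)" "\<not> type_Pu J"
    using second_gen_coplanar[OF S] S by (auto simp: type_Pf_def type_Pu_def second_gen_def)
  have m: "mid (refedge Y) = m"
    using S by (simp add: second_gen_def)
  have V': "verts J = {t, w, m, n}" and d': "distinct [t, w, m, n]" and e': "refedge J = {t, w}"
    and z: "?z = mid {t, w}"
    using V d e by (auto simp: insert_commute)
  have "X = child J w \<or> X = child J t"
    using assms(2) e by (auto simp: children_def)
  then show thesis
  proof
    assume X: "X = child J w"
    note C = child_explicit[OF T V d e refl, folded X]
    have "third_gen Y X w w' t w m n ?z"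
      unfolding third_gen_def
    proof (intro conjI)
      show "mark X {?z, m, n} = (if coplanar_marks Y then {m, n} else {?z, m})"
        using C(7) by (simp add: Pf second_gen_common_endpoint[OF S])
      show "mark X {w, m, n} = refedge X"
        "refedge X = (if w = w then {w, m} else if coplanar_marks Y then {w, n} else {w, m})"
        using C(4,6) S by (auto simp: second_gen_def)
    qed (use C w' Pf m in auto)
    then show thesis using that by blast
  next
    assume X: "X = child J t"
    note C = child_explicit[OF T V' d' e' z, folded X]
    have "third_gen Y X w w' t t m n ?z"
      unfolding third_gen_def
    proof (intro conjI)
      show "mark X {?z, m, n} = (if coplanar_marks Y then {m, n} else {?z, m})"
        using C(7) by (simp add: Pf second_gen_common_endpoint[OF S])
      show "mark X {t, m, n} = refedge X"
        "refedge X = (if t = w then {t, m} else if coplanar_marks Y then {t, n} else {t, m})"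
        using C(4,6) S d by (auto simp: second_gen_def insert_commute)
    qed (use C w' Pf m in auto)
    then show thesis using that by blast
  qed
qed

section \<open>Coordinates and open cells under a single bisection\<close>

definition proper :: "marked_tet \<Rightarrow> bool" where
  "proper K \<longleftrightarrow> tetrahedron (verts K) \<and> refedge K \<in> edges K"

lemma cut_pair:
  "l b \<le> l a \<Longrightarrow> cut {a, b} l =
     (\<lambda>y. l y - (if y = a \<or> y = b then l b else 0) + (if y = mid {a, b} then 2 * l b else 0))"
  by (auto simp: cut_def min_def fun_eq_iff)

lemma proper_child:
  assumes "proper K" "J \<in> children K"
  obtains a b where "refedge K = {a, b}" "a \<noteq> b" "{a, b} \<subseteq> verts K" "J = child K a"
    "verts J = insert (mid (refedge K)) (verts K - {b})"
    "tetrahedron (verts J)"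
proof -
  obtain a where a: "a \<in> refedge K" "J = child K a"
    using assms(2) by (auto simp: children_def)
  have T: "tetrahedron (verts K)" "card (refedge K) = 2" "refedge K \<subseteq> verts K"
    using assms(1) by (auto simp: proper_def edges_of_def)
  obtain b where b: "refedge K = {a, b}" "a \<noteq> b"
    using card_2_other[OF T(2) a(1)] .
  have "verts J = insert (mid (refedge K)) (verts K - {b})"
    using b by (auto simp: a(2) child_def Let_def inherited_face_def)
  then show thesis
    using tetrahedron_half[of "verts K" a b] T b a by (intro that[of a b]) auto
qed

lemma barycentric_child_iff:
  assumes "proper K" "refedge K = {a, b}" "a \<noteq> b"
  shows "barycentric (verts (child K a)) x l' \<longleftrightarrow>
         (\<exists>l. barycentric (verts K) x l \<and> l b \<le> l a \<and> l' = cut (refedge K) l)"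
proof -
  have "tetrahedron (verts K)" "{a, b} \<subseteq> verts K"
    using assms by (auto simp: proper_def edges_of_def)
  moreover have "verts (child K a) = insert (mid {a, b}) (verts K - {b})"
    using assms by (auto simp: child_def Let_def inherited_face_def)
  ultimately show ?thesis
    using barycentric_half_iff[of "verts K" a b] assms by simp
qed

lemma barycentric_child:
  assumes "proper K" "J \<in> children K" "barycentric (verts J) x l'"
  obtains l where "barycentric (verts K) x l" "l' = cut (refedge K) l"
  using proper_child[OF assms(1,2)] barycentric_child_iff[OF assms(1)] assms(3) by metis

lemma barycentric_child_exists:
  assumes "proper K" "barycentric (verts K) x l"
  obtains J where "J \<in> children K" "barycentric (verts J) x (cut (refedge K) l)"
proof -
  have "card (refedge K) = 2"
    using assms(1) by (auto simp: proper_def edges_of_def)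
  then obtain a b where ab: "refedge K = {a, b}" "a \<noteq> b"
    by (auto simp: card_2_iff)
  have ba: "refedge K = {b, a}"
    using ab by auto
  show thesis
  proof (cases "l b \<le> l a")
    case True
    then have "barycentric (verts (child K a)) x (cut (refedge K) l)"
      using barycentric_child_iff[OF assms(1) ab] assms(2) by metis
    then show thesis
      using that ab by (auto simp: children_def)
  next
    case False
    then have "l a \<le> l b" by simp
    then have "barycentric (verts (child K b)) x (cut (refedge K) l)"
      using barycentric_child_iff[OF assms(1) ba ab(2)[symmetric]] assms(2) by metis
    then show thesis
      using that ba by (auto simp: children_def)
  qed
qed

text \<open>An endpoint of weight zero makes the minimum zero. So only points whose support contains
  the bisected edge get new coordinates.\<close>

lemma cut_trivial:
  assumes "barycentric V x l" "card e = 2" "\<not> e \<subseteq> {y. l y \<noteq> 0}"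
  shows "cut e l = l"
proof -
  obtain a b where e: "e = {a, b}"
    using assms(2) by (auto simp: card_2_iff)
  then have "min (l a) (l b) = 0"
    using assms(3) barycentric_ge0[OF assms(1), of a] barycentric_ge0[OF assms(1), of b]
    by (auto simp: min_def)
  then have "Min (l ` e) = 0"
    by (simp add: e)
  then show ?thesis
    by (auto simp: cut_def fun_eq_iff)
qed

text \<open>The open tetrahedron, described by positive weights. It shrinks strictly under bisection
  and the two children have disjoint ones, so it serves to tell the nodes of the forest
  apart.\<close>

definition core :: "marked_tet \<Rightarrow> point set" where
  "core K = {x. \<exists>l. barycentric (verts K) x l \<and> (\<forall>y\<in>verts K. 0 < l y)}"

lemma center_in_core:
  assumes "tetrahedron (verts K)"
  obtains x where "x \<in> core K" "barycentric (verts K) x (\<lambda>y. if y \<in> verts K then 1 / 4 else 0)"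
proof -
  let ?l = "\<lambda>y. if y \<in> verts K then 1 / 4 else (0::real)"
  have "barycentric (verts K) (\<Sum>y\<in>verts K. ?l y *\<^sub>R y) ?l"
    using assms by (simp add: barycentric_def tetrahedron_card)
  then show thesis
    using that by (force simp: core_def)
qed

lemma core_child:
  assumes "proper K" "refedge K = {a, b}" "a \<noteq> b" "x \<in> core (child K a)"
  obtains l where "barycentric (verts K) x l" "\<forall>y\<in>verts K. 0 < l y" "l b < l a"
proof -
  have T: "tetrahedron (verts K)" "{a, b} \<subseteq> verts K"
    using assms by (auto simp: proper_def edges_of_def)
  have m: "mid {a, b} \<notin> verts K"
    using mid_not_vertex T assms(3) by simp
  have v: "verts (child K a) = insert (mid {a, b}) (verts K - {b})"
    using assms by (auto simp: child_def Let_def inherited_face_def)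
  obtain l' where l': "barycentric (verts (child K a)) x l'" "\<forall>y\<in>verts (child K a). 0 < l' y"
    using assms(4) by (auto simp: core_def)
  then obtain l where l: "barycentric (verts K) x l" "l b \<le> l a" "l' = cut {a, b} l"
    using barycentric_child_iff[OF assms(1-3)] assms(2) by auto
  have lm: "l (mid {a, b}) = 0"
    using barycentric_outside[OF l(1) m] .
  have lc: "l' y = l y - (if y = a \<or> y = b then l b else 0) + (if y = mid {a, b} then 2 * l b else 0)" for y
    using cut_pair[of l b a] l by simp
  have mn: "mid {a, b} \<noteq> a" "mid {a, b} \<noteq> b"
    using m T by auto
  have "0 < l' (mid {a, b})" "0 < l' a"
    using l'(2) v T assms(3) by auto
  \<comment> \<open>In the child, the midpoint has weight \<open>2 * l b\<close> and
    \<open>a\<close> has weight \<open>l a - l b\<close>.\<close>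
  then have ab: "0 < l b" "l b < l a"
    using lc[of "mid {a, b}"] lc[of a] lm mn by auto
  have "0 < l y" if "y \<in> verts K" for y
  proof (cases "y = a \<or> y = b")
    case False
    then have "0 < l' y" "y \<noteq> mid {a, b}"
      using that l'(2) v m by auto
    then show ?thesis using lc[of y] False by simp
  qed (use ab in auto)
  then show thesis using that l ab by blast
qed

text \<open>The inclusion is strict because the barycentre of \<open>K\<close> has equal weights at
  \<open>a\<close> and \<open>b\<close>: it lies on the cut and in no open child.\<close>

lemma core_child_subset:
  assumes "proper K" "J \<in> children K"
  shows "core J \<subset> core K"
proof -
  obtain a b where ab: "refedge K = {a, b}" "a \<noteq> b" "{a, b} \<subseteq> verts K" "J = child K a"
    using proper_child[OF assms] by metis
  have T: "tetrahedron (verts K)"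
    using assms(1) by (simp add: proper_def)
  have "core J \<subseteq> core K"
  proof
    fix x assume "x \<in> core J"
    then obtain l where "barycentric (verts K) x l" "\<forall>y\<in>verts K. 0 < l y"
      using core_child[OF assms(1) ab(1,2), of x] ab(4) by metis
    then show "x \<in> core K"
      by (auto simp: core_def)
  qed
  moreover obtain x where x: "x \<in> core K" "barycentric (verts K) x (\<lambda>y. if y \<in> verts K then 1 / 4 else 0)"
    using center_in_core[OF T] .
  have "x \<notin> core J"
  proof
    assume "x \<in> core J"
    then obtain l where l: "barycentric (verts K) x l" "l b < l a"
      using core_child[OF assms(1) ab(1,2)] ab(4) by metis
    then have "l = (\<lambda>y. if y \<in> verts K then 1 / 4 else 0)"
      using tetrahedron_unique[OF T l(1) x(2)] by simp
    then show False using l(2) ab by auto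
  qed
  ultimately show ?thesis using x by blast
qed

text \<open>Points of one open child satisfy \<open>l b < l a\<close>, those of the other the
  reverse inequality.\<close>

lemma core_children_disjoint:
  assumes "proper K" "J \<in> children K" "J' \<in> children K" "J \<noteq> J'"
  shows "core J \<inter> core J' = {}"
proof -
  obtain a b where ab: "refedge K = {a, b}" "a \<noteq> b" "J = child K a"
    using proper_child[OF assms(1,2)] by metis
  have J': "J' = child K b"
    using assms(3,4) ab by (auto simp: children_def)
  have ba: "refedge K = {b, a}" using ab by auto
  have T: "tetrahedron (verts K)"
    using assms(1) by (simp add: proper_def)
  have False if x: "x \<in> core J" "x \<in> core J'" for x
  proof -
    obtain l where l: "barycentric (verts K) x l" "l b < l a"
      using core_child[OF assms(1) ab(1,2)] x ab(3) by metis
    obtain l' where l': "barycentric (verts K) x l'" "l' a < l' b"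
      using core_child[OF assms(1) ba ab(2)[symmetric]] x J' by metis
    show False
      using tetrahedron_unique[OF T l(1) l'(1)] l(2) l'(2) by simp
  qed
  then show ?thesis by blast
qed

lemma core_nonempty: "proper K \<Longrightarrow> core K \<noteq> {}"
  using center_in_core unfolding proper_def by blast

lemma plain_proper: "plain K \<Longrightarrow> proper K"
  by (simp add: plain_def proper_def)

lemma first_gen_proper: "first_gen Y J w w' t m \<Longrightarrow> proper J"
  by (auto simp: first_gen_def proper_def edges_of_def)

lemma second_gen_proper:
  assumes "second_gen Y J w t m n"
  shows "proper J"
proof -
  have "verts J = {w, t, m, n}" "distinct [w, t, m, n]" "refedge J = {w, t}" "tetrahedron {w, t, m, n}"
    using assms by (simp_all add: second_gen_def)
  then show ?thesis
    by (simp add: proper_def edges_of_def)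
qed

lemma third_gen_plain:
  assumes "third_gen Y X w w' t c m n z"
  shows "plain X"
proof -
  have V: "verts X = {c, z, m, n}" and d: "distinct [c, z, m, n]" and T: "tetrahedron {c, z, m, n}"
    and r: "refedge X = {c, m} \<or> refedge X = {c, n}"
    and mk: "mark X {c, m, n} = refedge X" "mark X {c, z, m} = {c, m}" "mark X {c, z, n} = {c, n}"
      "mark X {z, m, n} = {m, n} \<or> mark X {z, m, n} = {z, m}" and f: "\<not> flag X"
    using assms by (simp_all add: third_gen_def)
  have fc: "faces X = {{c, z, m}, {c, z, n}, {c, m, n}, {z, m, n}}"
    using faces_of_4[OF d] V by simp
  have "mark X F \<in> edges_of F" if "F \<in> faces X" for F
    using that mk r d unfolding fc edges_of_def by auto
  moreover have "mark X F = refedge X" if "F \<in> faces X" "refedge X \<subseteq> F" for F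
    using that mk r d unfolding fc by auto
  moreover have "refedge X \<in> edges X"
    using r d by (auto simp: V edges_of_def)
  ultimately show ?thesis
    using T f by (simp add: plain_def V)
qed

section \<open>Uniform refinement, split into cycles of three generations\<close>

lemma uniform_Suc: "uniform S (Suc n) = (\<Union>K\<in>uniform S n. children K)"
  by (simp add: bisect_def)

declare uniform.simps(2) [simp del]

lemma uniform_add: "uniform S (n + k) = uniform (uniform S n) k"
  by (induction k) (simp_all add: uniform_Suc)

lemma uniform_UN: "uniform S k = (\<Union>K\<in>S. uniform {K} k)"
  by (induction k) (auto simp add: uniform_Suc)

lemma uniform_one [simp]: "uniform {K} (Suc 0) = children K"
  by (simp add: uniform_Suc)

lemma uniform_two: "uniform {K} 2 = (\<Union>J\<in>children K. children J)"
  by (simp add: numeral_2_eq_2 uniform_Suc)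

lemma uniform_three: "uniform {K} 3 = (\<Union>J1\<in>children K. \<Union>J2\<in>children J1. children J2)"
  by (simp add: numeral_3_eq_3 uniform_Suc)

lemma uniform_addE:
  assumes "X \<in> uniform S (n + k)"
  obtains Y where "Y \<in> uniform S n" "X \<in> uniform {Y} k"
  using assms uniform_add uniform_UN by blast

lemma uniform_addI: "Y \<in> uniform S n \<Longrightarrow> X \<in> uniform {Y} k \<Longrightarrow> X \<in> uniform S (n + k)"
  using uniform_add uniform_UN by blast

lemma third_gen_uniform:
  assumes "plain Y" "X \<in> uniform {Y} 3"
  obtains w w' t c m n z where "third_gen Y X w w' t c m n z"
proof -
  obtain J J2 where J: "J \<in> children Y" "J2 \<in> children J" "X \<in> children J2"
    using assms(2) by (auto simp: uniform_three)
  obtain u u' t m where F: "first_gen Y J u u' t m"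
    using first_gen_exists[OF assms(1) J(1)] .
  obtain w n where "second_gen Y J2 w t m n"
    using second_gen_exists[OF F J(2)] .
  then show thesis
    using third_gen_exists J(3) that by metis
qed

lemma uniform_3_plain: "plain Y \<Longrightarrow> X \<in> uniform {Y} 3 \<Longrightarrow> plain X"
  using third_gen_uniform third_gen_plain by metis

lemma uniform_below_3_proper:
  assumes "plain Y" "K \<in> uniform {Y} j" "j < 3"
  shows "proper K"
proof -
  consider "j = 0" | "j = 1" | "j = 2" using assms(3) by linarith
  then show ?thesis
  proof cases
    case 1
    then show ?thesis using assms plain_proper by simp
  next
    case 2
    then show ?thesis
      using assms first_gen_exists[OF assms(1)] first_gen_proper by (metis One_nat_def uniform_one)
  next
    case 3
    then obtain J where J: "J \<in> children Y" "K \<in> children J"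
      using assms(2) by (auto simp: uniform_two)
    then show ?thesis
      using first_gen_exists[OF assms(1)] second_gen_exists second_gen_proper by metis
  qed
qed

lemma uniform_plain:
  assumes "\<And>K. K \<in> T0 \<Longrightarrow> plain K" "K \<in> uniform T0 (3 * q)"
  shows "plain K"
  using assms(2)
proof (induction q arbitrary: K)
  case (Suc q)
  have "3 * Suc q = 3 * q + 3" by simp
  then have "K \<in> uniform T0 (3 * q + 3)" using Suc.prems by metis
  then show ?case
    using uniform_addE Suc.IH uniform_3_plain by metis
qed (use assms in simp)

lemma uniform_split:
  assumes "K \<in> uniform T0 n"
  obtains X where "X \<in> uniform T0 (3 * (n div 3))" "K \<in> uniform {X} (n mod 3)"
proof -
  have "K \<in> uniform T0 (3 * (n div 3) + n mod 3)" using assms by simp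
  then show thesis using uniform_addE that by metis
qed

lemma uniform_proper:
  assumes "\<And>K. K \<in> T0 \<Longrightarrow> plain K" "K \<in> uniform T0 n"
  shows "proper K"
  using uniform_split[OF assms(2)] uniform_plain[OF assms(1)] uniform_below_3_proper
  by (metis mod_less_divisor zero_less_numeral)

section \<open>Conformity of the uniform meshes\<close>

text \<open>Conformity in a form that can be carried through bisection: by
  \<open>coords_agree\<close>, the vertices with positive weight at a common point belong to both
  tetrahedra, so the intersection is the hull of the common vertices. By \<open>verts_inj\<close>,
  an element can be recovered from its vertex set.\<close>

locale compatible_mesh =
  fixes U :: "marked_tet set"
  assumes plain: "K \<in> U \<Longrightarrow> plain K"
    and coords_agree: "K \<in> U \<Longrightarrow> K' \<in> U \<Longrightarrow> barycentric (verts K) x l \<Longrightarrow>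
      barycentric (verts K') x l' \<Longrightarrow> l = l'"
    and marks_agree: "K \<in> U \<Longrightarrow> K' \<in> U \<Longrightarrow> F \<in> faces K \<Longrightarrow> F \<in> faces K' \<Longrightarrow> mark K F = mark K' F"
    and verts_inj: "K \<in> U \<Longrightarrow> K' \<in> U \<Longrightarrow> verts K = verts K' \<Longrightarrow> K = K'"

lemma body_iff: "tetrahedron (verts K) \<Longrightarrow> x \<in> body K \<longleftrightarrow> (\<exists>l. barycentric (verts K) x l)"
  using hull_iff_barycentric tetrahedron_finite by (simp add: body_def)

context compatible_mesh
begin

lemma tet: "K \<in> U \<Longrightarrow> tetrahedron (verts K)"
  using plain by (simp add: plain_def)

lemma fin: "K \<in> U \<Longrightarrow> finite (verts K)"
  using tet tetrahedron_finite by blast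

lemma edge_card: "g \<in> edges K \<Longrightarrow> card g = 2" and edge_sub: "g \<in> edges K \<Longrightarrow> g \<subseteq> verts K"
  by (auto simp: edges_of_def)

lemma bary_vertex:
  assumes "z \<in> vertices U" "Z \<in> U" "barycentric (verts Z) z l"
  shows "l = (\<lambda>y. if y = z then 1 else 0)"
proof -
  obtain K where K: "K \<in> U" "z \<in> verts K"
    using assms(1) by (auto simp: vertices_def)
  show ?thesis
    using coords_agree[OF assms(2) K(1) assms(3) barycentric_vertex[OF K(2) fin[OF K(1)]]] .
qed

lemma bary_mid:
  assumes "g \<in> edges Y" "Y \<in> U" "Z \<in> U" "barycentric (verts Z) (mid g) l"
  shows "l = (\<lambda>y. if y \<in> g then 1 / 2 else 0)"
  using coords_agree[OF assms(3,2,4) barycentric_mid[OF edge_sub edge_card fin]] assms by simp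

text \<open>No vertex of the mesh hangs on \<open>Z\<close>: in a tetrahedron having
  \<open>z\<close> as a vertex its coordinates are concentrated at \<open>z\<close>, hence also in
  \<open>Z\<close>.\<close>

lemma vertex_in_body:
  assumes "z \<in> vertices U" "Z \<in> U" "z \<in> body Z"
  shows "z \<in> verts Z"
proof -
  obtain l where l: "barycentric (verts Z) z l"
    using assms(3) body_iff[OF tet[OF assms(2)]] by auto
  have "l z \<noteq> 0"
    using bary_vertex[OF assms(1,2) l] by simp
  then show ?thesis
    using barycentric_outside[OF l] by blast
qed

lemma mid_in_body:
  assumes "g \<in> edges Y" "Y \<in> U" "Z \<in> U" "mid g \<in> body Z"
  shows "g \<subseteq> verts Z"
proof
  fix y assume y: "y \<in> g"
  obtain l where l: "barycentric (verts Z) (mid g) l"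
    using assms(4) body_iff[OF tet[OF assms(3)]] by auto
  have "l y \<noteq> 0"
    using bary_mid[OF assms(1-3) l] y by simp
  then show "y \<in> verts Z"
    using barycentric_outside[OF l] by blast
qed

lemma mid_in_own_body: "g \<in> edges Y \<Longrightarrow> Y \<in> U \<Longrightarrow> \<exists>l. barycentric (verts Y) (mid g) l"
  using barycentric_mid[OF edge_sub edge_card fin] by blast

text \<open>As a vertex the point would have weight 1 at itself, as a midpoint at most 1/2.\<close>

lemma mid_not_old:
  assumes "g \<in> edges Y" "Y \<in> U"
  shows "mid g \<notin> vertices U"
proof
  assume v: "mid g \<in> vertices U"
  obtain l where l: "barycentric (verts Y) (mid g) l"
    using mid_in_own_body[OF assms] by blast
  have "(if mid g \<in> g then 1 / 2 else 0) = (1::real)"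
    using fun_cong[OF bary_vertex[OF v assms(2) l], of "mid g"]
      fun_cong[OF bary_mid[OF assms(1,2,2) l], of "mid g"] by simp
  then show False by (simp split: if_splits)
qed

lemma mid_inj:
  assumes "g \<in> edges Y" "Y \<in> U" "h \<in> edges Z" "Z \<in> U" "mid g = mid h"
  shows "g = h"
proof -
  obtain l where l: "barycentric (verts Y) (mid g) l"
    using mid_in_own_body[OF assms(1,2)] by blast
  then have l': "barycentric (verts Y) (mid h) l"
    using assms(5) by simp
  have "l y = (if y \<in> g then 1 / 2 else 0)" "l y = (if y \<in> h then 1 / 2 else 0)" for y
    using fun_cong[OF bary_mid[OF assms(1,2,2) l], of y]
      fun_cong[OF bary_mid[OF assms(3,4,2) l'], of y] by simp_all
  then have "(y \<in> g) = (y \<in> h)" for y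
    by (metis zero_neq_one divide_eq_0_iff zero_neq_numeral)
  then show ?thesis by blast
qed

text \<open>
  The normal form: the coordinates with respect to the third-generation descendant are obtained by
  repeatedly cutting the first edge among the old vertices in the support.
\<close>

definition first_edge :: "point set \<Rightarrow> point set" where
  "first_edge S = (if card S = 2 then S
     else if card S = 3 then THE e. \<exists>K\<in>U. S \<in> faces K \<and> mark K S = e
     else THE e. \<exists>K\<in>U. verts K = S \<and> refedge K = e)"

definition reduce :: "(point \<Rightarrow> real) \<Rightarrow> point \<Rightarrow> real" where
  "reduce l = (let S = {y \<in> vertices U. l y \<noteq> 0} in if card S \<ge> 2 then cut (first_edge S) l else l)"

lemma first_edge_face:
  assumes "K \<in> U" "S \<in> faces K"
  shows "first_edge S = mark K S"
proof -
  have "card S = 3" using assms(2) by (simp add: faces_of_def)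
  moreover have "(THE e. \<exists>K\<in>U. S \<in> faces K \<and> mark K S = e) = mark K S"
  proof (rule the_equality)
    fix e assume "\<exists>K\<in>U. S \<in> faces K \<and> mark K S = e"
    then obtain K' where K': "K' \<in> U" "S \<in> faces K'" "mark K' S = e" by blast
    then show "e = mark K S"
      using marks_agree[OF K'(1) assms(1) K'(2) assms(2)] by simp
  qed (use assms in blast)
  ultimately show ?thesis by (simp add: first_edge_def)
qed

lemma first_edge_tet:
  assumes "K \<in> U"
  shows "first_edge (verts K) = refedge K"
proof -
  have "(THE e. \<exists>K'\<in>U. verts K' = verts K \<and> refedge K' = e) = refedge K"
  proof (rule the_equality)
    fix e assume "\<exists>K'\<in>U. verts K' = verts K \<and> refedge K' = e"
    then obtain K' where K': "K' \<in> U" "verts K' = verts K" "refedge K' = e" by blast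
    then show "e = refedge K"
      using verts_inj[OF K'(1) assms K'(2)] by simp
  qed (use assms in blast)
  then show ?thesis
    using tet[OF assms] by (simp add: first_edge_def tetrahedron_card)
qed

lemma first_gen_facts:
  assumes "Y \<in> U" "first_gen Y J w w' t m"
  shows "verts J \<inter> vertices U = {w, w', t}" "refedge J = {w, w'}" "w \<noteq> w'" "w \<noteq> t" "w' \<noteq> t"
    "{w, w', t} \<in> faces Y" "mark Y {w, w', t} = {w, w'}"
proof -
  have f: "verts J = {w, w', t, m}" "mid (refedge Y) = m" "{w, w', t} \<in> faces Y"
    using assms(2) by (simp_all add: first_gen_def)
  have "refedge Y \<in> edges Y"
    using plain[OF assms(1)] by (simp add: plain_def)
  then have "m \<notin> vertices U"
    using mid_not_old f(2) assms(1) by metis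
  moreover have "{w, w', t} \<subseteq> vertices U"
    using f(3) assms(1) by (auto simp: faces_of_def vertices_def)
  ultimately show "verts J \<inter> vertices U = {w, w', t}"
    using f(1) by auto
qed (use assms(2) in \<open>simp_all add: first_gen_def\<close>)

lemma second_gen_facts:
  assumes "Y \<in> U" "second_gen Y J w t m n"
  shows "verts J \<inter> vertices U = {w, t}" "refedge J = {w, t}" "{w, t} \<in> edges Y"
proof -
  obtain w' where w': "mid {w, w'} = n" "distinct [w, w', t]" "{w, w', t} \<in> faces Y"
    using assms(2) by (auto simp: second_gen_def)
  have f: "verts J = {w, t, m, n}" "mid (refedge Y) = m"
    using assms(2) by (simp_all add: second_gen_def)
  have "refedge Y \<in> edges Y"
    using plain[OF assms(1)] by (simp add: plain_def)
  then have "m \<notin> vertices U"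
    using mid_not_old f(2) assms(1) by metis
  moreover have e: "{w, w'} \<in> edges Y" "{w, t} \<in> edges Y"
    using w' by (auto simp: faces_of_def edges_of_def)
  then have "n \<notin> vertices U"
    using mid_not_old w'(1) assms(1) by metis
  moreover have "{w, t} \<subseteq> vertices U"
    using e(2) assms(1) by (auto simp: edges_of_def vertices_def)
  ultimately show "verts J \<inter> vertices U = {w, t}"
    using f(1) by auto
  show "{w, t} \<in> edges Y" by fact
qed (use assms(2) in \<open>simp add: second_gen_def\<close>)

lemma third_gen_facts:
  assumes "Y \<in> U" "third_gen Y X w w' t c m n z"
  shows "verts X = {c, z, m, n}" "distinct [c, z, m, n]" "m = mid (refedge Y)" "n = mid {w, w'}"
    "z = mid {w, t}" "c = w \<or> c = t" "w \<noteq> w'" "w \<noteq> t" "w' \<noteq> t" "{w, w', t} \<in> faces Y"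
    "mark Y {w, w', t} = {w, w'}" "\<not> refedge Y \<subseteq> {w, w', t}"
    "{w, w'} \<in> edges Y" "{w, t} \<in> edges Y" "refedge Y \<in> edges Y"
    "c \<in> vertices U" "m \<notin> vertices U" "n \<notin> vertices U" "z \<notin> vertices U"
    "verts X \<inter> vertices U = {c}" "c \<in> verts Y"
proof -
  show a: "verts X = {c, z, m, n}" "distinct [c, z, m, n]" "m = mid (refedge Y)" "n = mid {w, w'}"
    "z = mid {w, t}" "c = w \<or> c = t" "w \<noteq> w'" "w \<noteq> t" "w' \<noteq> t" "{w, w', t} \<in> faces Y"
    "mark Y {w, w', t} = {w, w'}" "\<not> refedge Y \<subseteq> {w, w', t}"
    using assms(2) by (simp_all add: third_gen_def)
  show r: "refedge Y \<in> edges Y"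
    using plain[OF assms(1)] by (simp add: plain_def)
  show e: "{w, w'} \<in> edges Y" "{w, t} \<in> edges Y"
    using a by (auto simp: faces_of_def edges_of_def)
  show "c \<in> verts Y"
    using a(6) e by (auto simp: edges_of_def)
  then show c: "c \<in> vertices U"
    using assms(1) by (auto simp: vertices_def)
  show n: "m \<notin> vertices U" "n \<notin> vertices U" "z \<notin> vertices U"
    using mid_not_old r e assms(1) a by auto
  show "verts X \<inter> vertices U = {c}"
    using n c a(1) by auto
qed

text \<open>The old vertices carrying weight form the bisected edge itself, or a face marked by it,
  or all of \<open>Y\<close>. In each case the edge can be read off from \<open>S\<close> and the
  marks of the mesh, so every tetrahedron containing the point prescribes the same cut.\<close>

lemma refedge_first:
  assumes "Y \<in> U" "J \<in> uniform {Y} j" "j < 3" "refedge J \<subseteq> S" "S \<subseteq> verts J \<inter> vertices U"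
  shows "first_edge S = refedge J" "card S \<ge> 2"
proof -
  have "card (refedge J) = 2" and T: "tetrahedron (verts J)"
    using uniform_below_3_proper[OF plain[OF assms(1)] assms(2,3)]
    by (auto simp: proper_def edges_of_def)
  moreover have "finite S"
    using assms(5) T tetrahedron_finite finite_subset by blast
  ultimately show c2: "card S \<ge> 2"
    using card_mono[of S "refedge J"] assms(4) by simp
  have two: "first_edge S = refedge J" if "S = refedge J"
    using that \<open>card (refedge J) = 2\<close> by (simp add: first_edge_def)
  consider "j = 0" | "j = 1" | "j = 2" using assms(3) by linarith
  then show "first_edge S = refedge J"
  proof cases
    case 1
    then have J: "J = Y" using assms(2) by simp
    have "card S \<le> 4"
      using card_mono[of "verts Y" S] fin tet assms(1,5) J by (auto simp: tetrahedron_card)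
    then consider "card S = 2" | "card S = 3" | "card S = 4" using c2 by linarith
    then show ?thesis
    proof cases
      case 1
      then have "refedge J = S"
        using card_subset_eq[OF \<open>finite S\<close> assms(4)] \<open>card (refedge J) = 2\<close> by simp
      then show ?thesis using two by simp
    next
      case 2
      then have "S \<in> faces Y"
        using assms(5) J by (auto simp: faces_of_def)
      then show ?thesis
        using first_edge_face[OF assms(1)] plain[OF assms(1)] assms(4) J by (simp add: plain_def)
    next
      case 3
      then have "S = verts Y"
        using assms(1,5) J card_subset_eq[OF fin[OF assms(1)], of S] tet[OF assms(1)]
        by (auto simp: tetrahedron_card)
      then show ?thesis
        using first_edge_tet[OF assms(1)] J by simp
    qed
  next
    case 2
    then have "J \<in> children Y" using assms(2) by simp
    then obtain w w' t m where F: "first_gen Y J w w' t m"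
      using first_gen_exists[OF plain[OF assms(1)]] by metis
    note f = first_gen_facts[OF assms(1) F]
    have "S = {w, w'} \<or> S = {w, w', t}"
      using assms(4,5) f by auto
    then show ?thesis
      using two f first_edge_face[OF assms(1) f(6)] by auto
  next
    case 3
    then obtain J1 where J1: "J1 \<in> children Y" "J \<in> children J1"
      using assms(2) by (auto simp: uniform_two)
    then obtain u u' t m where F: "first_gen Y J1 u u' t m"
      using first_gen_exists[OF plain[OF assms(1)]] by metis
    obtain w n where "second_gen Y J w t m n"
      using second_gen_exists[OF F J1(2)] by metis
    from second_gen_facts(1,2)[OF assms(1) this] have "S = refedge J"
      using assms(4,5) by auto
    then show ?thesis
      using two by simp
  qed
qed

text \<open>Within one cycle only edges between old vertices are bisected: a midpoint becomes an
  endpoint of a refinement edge only after the cycle is complete.\<close>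

lemma refedge_in_edges:
  assumes "Y \<in> U" "J \<in> uniform {Y} j" "j < 3"
  shows "refedge J \<in> edges Y"
proof -
  consider "j = 0" | "j = 1" | "j = 2" using assms(3) by linarith
  then show ?thesis
  proof cases
    case 1
    then show ?thesis using assms(2) plain[OF assms(1)] by (simp add: plain_def)
  next
    case 2
    then have "J \<in> children Y" using assms(2) by simp
    then obtain w w' t m where F: "first_gen Y J w w' t m"
      using first_gen_exists[OF plain[OF assms(1)]] by metis
    from first_gen_facts[OF assms(1) F] show ?thesis
      by (auto simp: edges_of_def faces_of_def)
  next
    case 3
    then obtain J1 where J1: "J1 \<in> children Y" "J \<in> children J1"
      using assms(2) by (auto simp: uniform_two)
    then obtain u u' t m where F: "first_gen Y J1 u u' t m"
      using first_gen_exists[OF plain[OF assms(1)]] by metis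
    obtain w n where "second_gen Y J w t m n"
      using second_gen_exists[OF F J1(2)] by metis
    from second_gen_facts(2,3)[OF assms(1) this] show ?thesis
      by simp
  qed
qed

lemma cut_refedge_reduce:
  assumes "Y \<in> U" "J \<in> uniform {Y} j" "j < 3" "barycentric (verts J) x l"
  shows "cut (refedge J) l = l \<or> cut (refedge J) l = reduce l"
proof (cases "refedge J \<subseteq> {y \<in> vertices U. l y \<noteq> 0}")
  case True
  have "{y \<in> vertices U. l y \<noteq> 0} \<subseteq> verts J \<inter> vertices U"
    using barycentric_outside[OF assms(4)] by auto
  from refedge_first[OF assms(1-3) True this] show ?thesis
    by (simp add: reduce_def)
next
  case False
  have "refedge J \<in> edges Y"
    using refedge_in_edges[OF assms(1-3)] .
  then have "refedge J \<subseteq> vertices U" "card (refedge J) = 2"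
    using assms(1) by (auto simp: edges_of_def vertices_def)
  then show ?thesis
    using False cut_trivial[OF assms(4), of "refedge J"] by auto
qed

text \<open>Only one vertex of \<open>X\<close> is old, and \<open>reduce\<close> acts only on
  supports with at least two old vertices.\<close>

lemma reduce_third_gen:
  assumes "Y \<in> U" "X \<in> uniform {Y} 3" "barycentric (verts X) x l"
  shows "reduce l = l"
proof -
  obtain w w' t c m n z where T: "third_gen Y X w w' t c m n z"
    using third_gen_uniform[OF plain[OF assms(1)] assms(2)] .
  have "{y \<in> vertices U. l y \<noteq> 0} \<subseteq> {c}"
    using barycentric_outside[OF assms(3)] third_gen_facts(20)[OF assms(1) T] by auto
  then have "card {y \<in> vertices U. l y \<noteq> 0} \<le> 1"
    using card_mono[of "{c}"] by fastforce
  then show ?thesis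
    by (simp add: reduce_def)
qed

text \<open>The key to conformity: the new coordinates depend on the old ones alone, not on
  \<open>Y\<close> or on the branch that leads to \<open>X\<close>.\<close>

lemma barycentric_third_gen:
  assumes "Y \<in> U" "X \<in> uniform {Y} 3" "barycentric (verts X) x l"
  obtains l0 where "barycentric (verts Y) x l0" "l = reduce (reduce (reduce l0))"
proof -
  obtain J1 J2 where J: "J1 \<in> children Y" "J2 \<in> children J1" "X \<in> children J2"
    using assms(2) by (auto simp: uniform_three)
  have u: "Y \<in> uniform {Y} 0" "J1 \<in> uniform {Y} 1" "J2 \<in> uniform {Y} 2"
    using J by (auto simp: uniform_two)
  have p: "proper Y" "proper J1" "proper J2"
    using uniform_below_3_proper[OF plain[OF assms(1)] u(1)] uniform_below_3_proper[OF plain[OF assms(1)] u(2)]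
     uniform_below_3_proper[OF plain[OF assms(1)] u(3)] by simp_all
  obtain l2 where l2: "barycentric (verts J2) x l2" "l = cut (refedge J2) l2"
    using barycentric_child[OF p(3) J(3) assms(3)] .
  obtain l1 where l1: "barycentric (verts J1) x l1" "l2 = cut (refedge J1) l1"
    using barycentric_child[OF p(2) J(2) l2(1)] .
  obtain l0 where l0: "barycentric (verts Y) x l0" "l1 = cut (refedge Y) l0"
    using barycentric_child[OF p(1) J(1) l1(1)] .
  have "l1 = l0 \<or> l1 = reduce l0" "l2 = l1 \<or> l2 = reduce l1" "l = l2 \<or> l = reduce l2"
    using cut_refedge_reduce[OF assms(1) u(1) _ l0(1)] cut_refedge_reduce[OF assms(1) u(2) _ l1(1)]
      cut_refedge_reduce[OF assms(1) u(3) _ l2(1)] l0(2) l1(2) l2(2) by simp_all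
  moreover have "reduce l = l"
    using reduce_third_gen[OF assms] .
  \<comment> \<open>The number of cuts that change the coordinates varies between none and three. As
    \<open>l\<close> is fixed by \<open>reduce\<close>, the missing applications may be
    added.\<close>
  ultimately have "l = reduce (reduce (reduce l0))"
    by metis
  then show thesis using that l0(1) by blast
qed

lemma barycentric_third_gen_exists:
  assumes "Y \<in> U" "barycentric (verts Y) x l"
  obtains X l' where "X \<in> uniform {Y} 3" "barycentric (verts X) x l'"
proof -
  obtain J1 l1 where J1: "J1 \<in> children Y" "barycentric (verts J1) x l1"
    using barycentric_child_exists[OF plain_proper[OF plain[OF assms(1)]] assms(2)] by metis
  have u1: "J1 \<in> uniform {Y} 1" using J1 by simp
  obtain J2 l2 where J2: "J2 \<in> children J1" "barycentric (verts J2) x l2"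
    using barycentric_child_exists[OF uniform_below_3_proper[OF plain[OF assms(1)] u1] J1(2)]
    by (metis one_less_numeral_iff semiring_norm(77))
  have u2: "J2 \<in> uniform {Y} 2"
    using J1 J2 by (auto simp: uniform_two)
  obtain X l' where X: "X \<in> children J2" "barycentric (verts X) x l'"
    using barycentric_child_exists[OF uniform_below_3_proper[OF plain[OF assms(1)] u2] J2(2)]
    by (metis lessI numeral_2_eq_2 numeral_3_eq_3)
  have "X \<in> uniform {Y} 3"
    using J1 J2 X by (auto simp: uniform_three)
  then show thesis using that X(2) by blast
qed

end

lemma disjoint_cores_uniform:
  assumes "\<And>K. K \<in> T0 \<Longrightarrow> plain K"
    and "\<And>K K'. K \<in> T0 \<Longrightarrow> K' \<in> T0 \<Longrightarrow> K \<noteq> K' \<Longrightarrow> core K \<inter> core K' = {}"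
    and "K \<in> uniform T0 n" "K' \<in> uniform T0 n" "K \<noteq> K'"
  shows "core K \<inter> core K' = {}"
  using assms(3-5)
proof (induction n arbitrary: K K')
  case (Suc n)
  obtain J J' where J: "J \<in> uniform T0 n" "K \<in> children J" "J' \<in> uniform T0 n" "K' \<in> children J'"
    using Suc.prems by (auto simp: uniform_Suc)
  have p: "proper J" "proper J'"
    using uniform_proper[OF assms(1)] J by auto
  show ?case
  proof (cases "J = J'")
    case True
    then show ?thesis
      using core_children_disjoint[OF p(1)] J Suc.prems(3) by simp
  next
    case False
    then have "core J \<inter> core J' = {}"
      using Suc.IH J by simp
    then show ?thesis
      using core_child_subset[OF p(1) J(2)] core_child_subset[OF p(2) J(4)] by blast
  qed
qed (use assms(2) in simp)

section \<open>Carriers and marks in the third generation\<close>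

context compatible_mesh
begin

lemma cores_disjoint:
  assumes "K \<in> U" "K' \<in> U" "K \<noteq> K'"
  shows "core K \<inter> core K' = {}"
proof -
  have False if x: "x \<in> core K" "x \<in> core K'" for x
  proof -
    obtain l l' where l: "barycentric (verts K) x l" "\<forall>y\<in>verts K. 0 < l y"
      and l': "barycentric (verts K') x l'" "\<forall>y\<in>verts K'. 0 < l' y"
      using x by (auto simp: core_def)
    have "l = l'"
      using coords_agree[OF assms(1,2) l(1) l'(1)] .
    then have "y \<in> verts K \<longleftrightarrow> y \<in> verts K'" for y
      using l l' barycentric_outside[OF l(1), of y] barycentric_outside[OF l'(1), of y] by force
    then have "verts K = verts K'" by blast
    then show False
      using verts_inj assms by blast
  qed
  then show ?thesis by blast
qed

text \<open>The vertex set of the smallest simplex of the mesh containing \<open>z\<close>. The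
  union over all tetrahedra avoids a choice; by \<open>coords_agree\<close> each one containing
  \<open>z\<close> gives the same support.\<close>

definition carrier :: "point \<Rightarrow> point set" where
  "carrier z = {y. \<exists>K\<in>U. \<exists>l. barycentric (verts K) z l \<and> l y \<noteq> 0}"

lemma carrier_old:
  assumes "z \<in> vertices U"
  shows "carrier z = {z}"
proof -
  obtain K where K: "K \<in> U" "z \<in> verts K"
    using assms by (auto simp: vertices_def)
  have "z \<in> carrier z"
    using barycentric_vertex[OF K(2) fin[OF K(1)]] K(1) by (force simp: carrier_def)
  moreover have "y = z" if "y \<in> carrier z" for y
  proof -
    obtain Z l where "Z \<in> U" "barycentric (verts Z) z l" "l y \<noteq> 0"
      using \<open>y \<in> carrier z\<close> by (auto simp: carrier_def)
    then show ?thesis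
      using fun_cong[OF bary_vertex[OF assms], of Z l y] by (simp split: if_splits)
  qed
  ultimately show ?thesis by blast
qed

lemma carrier_mid:
  assumes "g \<in> edges Y" "Y \<in> U"
  shows "carrier (mid g) = g"
proof -
  have "y \<in> carrier (mid g)" if "y \<in> g" for y
    using that barycentric_mid[OF edge_sub[OF assms(1)] edge_card[OF assms(1)] fin[OF assms(2)]] assms(2)
    by (force simp: carrier_def)
  moreover have "y \<in> g" if y: "y \<in> carrier (mid g)" for y
  proof -
    obtain Z l where "Z \<in> U" "barycentric (verts Z) (mid g) l" "l y \<noteq> 0"
      using y by (auto simp: carrier_def)
    then show ?thesis
      using fun_cong[OF bary_mid[OF assms], of Z l y] by (simp split: if_splits)
  qed
  ultimately show ?thesis by blast
qed

text \<open>Each case expresses the mark by data that a neighbour sharing \<open>F\<close> also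
  sees: the carriers tell whether \<open>F\<close> lies in a face of \<open>Y\<close> or inside
  \<open>Y\<close>, and the old vertices separate the two kinds of inner faces.\<close>

lemma mark_cases:
  assumes "Y \<in> U" "X \<in> uniform {Y} 3" "F \<in> faces X"
  defines "m \<equiv> mid (refedge Y)"
  obtains
    (cut_face) S c where "S \<in> faces Y" "\<Union>(carrier ` F) = S" "F \<inter> vertices U = {c}"
      "mark X F = {c, mid (mark Y S)}"
  | (inner_old) c g where "\<Union>(carrier ` F) = verts Y" "F \<inter> vertices U = {c}" "F = {c, m, mid g}"
      "distinct [c, m, mid g]" "g \<in> edges Y"
      "mark X F = (if coplanar_marks Y \<and> c \<notin> g then {c, mid g} else {c, m})"
  | (inner_new) g h where "\<Union>(carrier ` F) = verts Y" "F \<inter> vertices U = {}" "F = {m, mid g, mid h}"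
      "distinct [m, mid g, mid h]" "g \<in> edges Y" "h \<in> edges Y" "mark Y (g \<union> h) = g"
      "mark X F = (if coplanar_marks Y then {m, mid g} else {m, mid h})"
proof -
  obtain w w' t c m' n z where T: "third_gen Y X w w' t c m' n z"
    using third_gen_uniform[OF plain[OF assms(1)] assms(2)] .
  note f = third_gen_facts[OF assms(1) T]
  have m': "m' = m" using f(3) by (simp add: m_def)
  note f = f[unfolded m']
  have mk: "mark X {c, m, n} = (if c = w then {c, m} else if coplanar_marks Y then {c, n} else {c, m})"
    "mark X {c, z, m} = {c, m}" "mark X {c, z, n} = {c, n}"
    "mark X {z, m, n} = (if coplanar_marks Y then {m, n} else {z, m})"
    using T m' by (simp_all add: third_gen_def)
  have "card (verts Y - {w, w', t}) = 1"
    using f(10) tet[OF assms(1)] fin[OF assms(1)]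
    by (subst card_Diff_subset) (auto simp: faces_of_def tetrahedron_card finite_subset)
  then obtain u where u: "verts Y - {w, w', t} = {u}"
    by (auto simp: card_1_singleton_iff)
  then have V: "verts Y = {w, w', t, u}" and u': "u \<notin> {w, w', t}"
    using f(10) by (auto simp: faces_of_def)
  \<comment> \<open>The vertex \<open>u\<close> is opposite the inherited face. The position of the
    other endpoint \<open>v\<close> decides which faces of \<open>X\<close> lie in a face of
    \<open>Y\<close>.\<close>
  have "u \<in> refedge Y"
    using f(12,15) V by (auto simp: edges_of_def)
  then obtain v where v: "refedge Y = {u, v}" "u \<noteq> v"
    using card_2_other[OF edge_card[OF f(15)]] by metis
  then have vc: "v \<in> {w, w', t}"
    using f(15) V by (auto simp: edges_of_def)
  have car: "carrier c = {c}" "carrier m = {u, v}" "carrier n = {w, w'}" "carrier z = {w, t}"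
    using carrier_old[OF f(16)] carrier_mid[OF f(15) assms(1)] carrier_mid[OF f(13) assms(1)]
      carrier_mid[OF f(14) assms(1)] f v by simp_all
  have ref: "mark Y S = refedge Y" if "S \<in> faces Y" "refedge Y \<subseteq> S" for S
    using plain[OF assms(1)] that by (simp add: plain_def)
  have fcY: "{w, w', u} \<in> faces Y" "{w, t, u} \<in> faces Y"
    using V u' f(7-9) by (auto simp: faces_of_def)
  have "F \<in> {{c, z, m}, {c, z, n}, {c, m, n}, {z, m, n}}"
    using assms(3) faces_of_4[OF f(2)] f(1) by simp
  then consider "F = {c, z, m}" | "F = {c, z, n}" | "F = {c, m, n}" | "F = {z, m, n}" by blast
  then show thesis
  proof cases
    case 1
    have old: "F \<inter> vertices U = {c}"
      using 1 f(16-19) by auto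
    show thesis
    proof (cases "v = w'")
      case True
      show thesis
      proof (rule inner_old[OF _ old])
        show "\<Union>(carrier ` F) = verts Y"
          using 1 car True V f(6) by auto
        show "F = {c, m, mid {w, t}}" "distinct [c, m, mid {w, t}]" "{w, t} \<in> edges Y"
          using 1 f(2,5,14) by auto
        show "mark X F = (if coplanar_marks Y \<and> c \<notin> {w, t} then {c, mid {w, t}} else {c, m})"
          using 1 mk f(6) by auto
      qed
    next
      case False
      then have vv: "v = w \<or> v = t" using vc by auto
      show thesis
      proof (rule cut_face[OF fcY(2) _ old])
        show "\<Union>(carrier ` F) = {w, t, u}"
          using 1 car vv f(6) by auto
        have "mark Y {w, t, u} = refedge Y"
          using ref[OF fcY(2)] v vv by auto
        then show "mark X F = {c, mid (mark Y {w, t, u})}"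
          using 1 mk by (simp add: m_def)
      qed
    qed
  next
    case 2
    have old: "F \<inter> vertices U = {c}"
      using 2 f(16-19) by auto
    show thesis
    proof (rule cut_face[OF f(10) _ old])
      show "\<Union>(carrier ` F) = {w, w', t}"
        using 2 car f(6) by auto
      show "mark X F = {c, mid (mark Y {w, w', t})}"
        using 2 mk f(4,11) by simp
    qed
  next
    case 3
    have old: "F \<inter> vertices U = {c}"
      using 3 f(16-19) by auto
    show thesis
    proof (cases "c = w \<and> v \<noteq> t")
      case True
      then have vv: "v = w \<or> v = w'" using vc by auto
      show thesis
      proof (rule cut_face[OF fcY(1) _ old])
        show "\<Union>(carrier ` F) = {w, w', u}"
          using 3 car vv True by auto
        have "mark Y {w, w', u} = refedge Y"
          using ref[OF fcY(1)] v vv by auto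
        then show "mark X F = {c, mid (mark Y {w, w', u})}"
          using 3 mk True by (simp add: m_def)
      qed
    next
      case False
      show thesis
      proof (rule inner_old[OF _ old])
        show "\<Union>(carrier ` F) = verts Y"
          using 3 car False V f(6) vc by auto
        show "F = {c, m, mid {w, w'}}" "distinct [c, m, mid {w, w'}]" "{w, w'} \<in> edges Y"
          using 3 f(2,4,13) by auto
        \<comment> \<open>The condition on \<open>c\<close> singles out \<open>c = t\<close> among
          \<open>c = w\<close> and \<open>c = t\<close>, without referring to the roles of
          \<open>w\<close> and \<open>t\<close> in \<open>X\<close>.\<close>
        show "mark X F = (if coplanar_marks Y \<and> c \<notin> {w, w'} then {c, mid {w, w'}} else {c, m})"
          using 3 mk(1) f(4,6,8,9) by auto
      qed
    qed
  next
    case 4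
    show thesis
    proof (rule inner_new)
      show "\<Union>(carrier ` F) = verts Y"
        using 4 car V vc by auto
      show "F \<inter> vertices U = {}"
        using 4 f(17-19) by auto
      show "F = {m, mid {w, w'}, mid {w, t}}" "distinct [m, mid {w, w'}, mid {w, t}]"
        "{w, w'} \<in> edges Y" "{w, t} \<in> edges Y"
        using 4 f(2,4,5,13,14) by auto
      have "{w, w'} \<union> {w, t} = {w, w', t}" by auto
      then show "mark Y ({w, w'} \<union> {w, t}) = {w, w'}"
        using f(11) by simp
      show "mark X F = (if coplanar_marks Y then {m, mid {w, w'}} else {m, mid {w, t}})"
        using 4 mk(4) f(4,5) by auto
    qed
  qed
qed

text \<open>The carriers cover three or four old vertices, and \<open>F\<close> has an old vertex or
  not; this shows that both sides fall under the same case. A cut face takes its mark from a face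
  shared in the coarse mesh, while an inner face determines \<open>Y\<close>.\<close>

lemma marks_agree_third_gen:
  assumes Y: "Y \<in> U" "X \<in> uniform {Y} 3" "F \<in> faces X"
    and Y': "Y' \<in> U" "X' \<in> uniform {Y'} 3" "F \<in> faces X'"
  shows "mark X F = mark X' F"
proof -
  have c3: "card S = 3" if "S \<in> faces K" for S K
    using that by (simp add: faces_of_def)
  have c4: "card (verts K) = 4" if "K \<in> U" for K
    using tet[OF that] by (simp add: tetrahedron_card)
  show ?thesis
    using Y
  proof (cases rule: mark_cases)
    case 1: (cut_face S c)
    show ?thesis
      using Y'
    proof (cases rule: mark_cases)
      case (cut_face S' c')
      then show ?thesis
        using 1 marks_agree[OF Y(1) Y'(1), of S] by simp
    qed (use 1 c3[OF 1(1)] c4[OF Y'(1)] in simp_all)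
  next
    case 2: (inner_old c g)
    show ?thesis
      using Y'
    proof (cases rule: mark_cases)
      case (cut_face S' c')
      then show ?thesis using 2 c3[OF cut_face(1)] c4[OF Y(1)] by simp
    next
      case 3: (inner_old c' g')
      have "Y = Y'"
        using verts_inj[OF Y(1) Y'(1)] 2(1) 3(1) by simp
      moreover have "c' = c"
        using 2(2) 3(2) by simp
      moreover from calculation have "mid g' = mid g"
        using 2(3,4) 3(3,4) by (auto simp: doubleton_eq_iff set_eq_iff)
      then have "g' = g"
        using mid_inj[OF 3(5) Y'(1) 2(5) Y(1)] by simp
      ultimately show ?thesis
        using 2(6) 3(6) by simp
    next
      case (inner_new g' h')
      then show ?thesis using 2(2) by simp
    qed
  next
    case 2: (inner_new g h)
    show ?thesis
      using Y'
    proof (cases rule: mark_cases)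
      case (cut_face S' c')
      then show ?thesis using 2 c3[OF cut_face(1)] c4[OF Y(1)] by simp
    next
      case (inner_old c' g')
      then show ?thesis using 2(2) by simp
    next
      case 3: (inner_new g' h')
      have YY: "Y = Y'"
        using verts_inj[OF Y(1) Y'(1)] 2(1) 3(1) by simp
      have drop: "{m, p, q} - {m} = {p, q}" if "distinct [m, p, q]" for m p q :: point
        using that by auto
      have "{mid g, mid h} = F - {mid (refedge Y)}"
        unfolding 2(3) by (rule drop[OF 2(4), symmetric])
      moreover have "{mid g', mid h'} = F - {mid (refedge Y)}"
        unfolding 3(3) YY by (rule drop[OF 3(4), symmetric])
      ultimately have "{mid g, mid h} = {mid g', mid h'}"
        by simp
      then consider "mid g = mid g'" "mid h = mid h'" | "mid g = mid h'" "mid h = mid g'"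
        by (auto simp: doubleton_eq_iff)
      then show ?thesis
      proof cases
        case 1
        then show ?thesis using 2(8) 3(8) YY by simp
      next
        case 2: 2
        \<comment> \<open>If the two midpoints exchanged their roles, the face
          \<open>g \<union> h\<close> of \<open>Y\<close> would be marked by \<open>g\<close> as
          well as by \<open>h\<close>.\<close>
        have "g = h'" "h = g'"
          using mid_inj[OF \<open>g \<in> edges Y\<close> Y(1) 3(6) Y'(1) 2(1)]
            mid_inj[OF \<open>h \<in> edges Y\<close> Y(1) 3(5) Y'(1) 2(2)] by auto
        then have "g = g'"
          using \<open>mark Y (g \<union> h) = g\<close> 3(7) YY by (simp add: Un_commute)
        then have "mid g = mid h"
          using 2(2) by simp
        then show ?thesis
          using \<open>distinct [mid (refedge Y), mid g, mid h]\<close> by simp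
      qed
    qed
  qed
qed

text \<open>Both coordinates of a common point are images of the same coarse coordinates under the
  same map. Tetrahedra with equal vertices have equal, nonempty cores, whereas different descendants
  have disjoint ones.\<close>

lemma compatible_uniform_3: "compatible_mesh (uniform U 3)"
proof
  have ex: "\<exists>Y\<in>U. X \<in> uniform {Y} 3" if "X \<in> uniform U 3" for X
    using that uniform_UN by blast
  show pl: "plain X" if "X \<in> uniform U 3" for X
    using ex[OF that] uniform_3_plain plain by blast
  show "l = l'" if X: "X \<in> uniform U 3" "X' \<in> uniform U 3" "barycentric (verts X) x l"
      "barycentric (verts X') x l'" for X X' x l l'
  proof -
    obtain Y Y' where Y: "Y \<in> U" "X \<in> uniform {Y} 3" and Y': "Y' \<in> U" "X' \<in> uniform {Y'} 3"
      using ex X(1,2) by blast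
    obtain l0 where l0: "barycentric (verts Y) x l0" "l = reduce (reduce (reduce l0))"
      using barycentric_third_gen[OF Y X(3)] .
    obtain l0' where l0': "barycentric (verts Y') x l0'" "l' = reduce (reduce (reduce l0'))"
      using barycentric_third_gen[OF Y' X(4)] .
    show ?thesis
      using coords_agree[OF Y(1) Y'(1) l0(1) l0'(1)] l0(2) l0'(2) by simp
  qed
  show "mark X F = mark X' F" if "X \<in> uniform U 3" "X' \<in> uniform U 3" "F \<in> faces X" "F \<in> faces X'"
    for X X' F
    using ex[OF that(1)] ex[OF that(2)] marks_agree_third_gen that(3,4) by blast
  show "X = X'" if "X \<in> uniform U 3" "X' \<in> uniform U 3" "verts X = verts X'" for X X'
  proof (rule ccontr)
    assume "X \<noteq> X'"
    then have "core X \<inter> core X' = {}"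
      using disjoint_cores_uniform[OF plain cores_disjoint that(1,2)] by blast
    moreover have "core X = core X'"
      using that(3) by (simp add: core_def)
    ultimately show False
      using core_nonempty[OF plain_proper[OF pl[OF that(1)]]] by simp
  qed
qed

end

section \<open>Induction over the levels, starting from the initial mesh\<close>

lemma compatible_uniform:
  assumes "compatible_mesh T0"
  shows "compatible_mesh (uniform T0 (3 * q))"
proof (induction q)
  case (Suc q)
  have "3 * Suc q = 3 * q + 3" by simp
  then have "uniform T0 (3 * Suc q) = uniform (uniform T0 (3 * q)) 3"
    using uniform_add by metis
  then show ?case
    using compatible_mesh.compatible_uniform_3[OF Suc] by simp
qed (use assms in simp)

lemma conforming_common_simplex:
  assumes "conforming T" "K \<in> T" "K' \<in> T" "K \<noteq> K'"
  obtains S where "S \<subseteq> verts K" "S \<subseteq> verts K'" "finite S" "card S \<le> 3"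
    "body K \<inter> body K' = convex hull S"
proof -
  have "body K \<inter> body K' = {} \<or>
        (\<exists>v \<in> verts K \<inter> verts K'. body K \<inter> body K' = {v}) \<or>
        (\<exists>e \<in> edges K \<inter> edges K'. body K \<inter> body K' = convex hull e) \<or>
        (\<exists>F \<in> faces K \<inter> faces K'. body K \<inter> body K' = convex hull F)"
    using assms by (simp add: conforming_def)
  then consider "body K \<inter> body K' = {}"
    | v where "v \<in> verts K \<inter> verts K'" "body K \<inter> body K' = {v}"
    | e where "e \<in> edges K \<inter> edges K'" "body K \<inter> body K' = convex hull e"
    | F where "F \<in> faces K \<inter> faces K'" "body K \<inter> body K' = convex hull F"
    by blast
  then show thesis
  proof cases
    case 1
    then show thesis using that[of "{}"] by simp
  next
    case 2
    then show thesis using that[of "{v}"] by simp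
  next
    case 3
    then have "card e = 2" "e \<subseteq> verts K" "e \<subseteq> verts K'" by (auto simp: edges_of_def)
    moreover from this have "finite e" by (metis card.infinite zero_neq_numeral)
    ultimately show thesis using that[of e] 3 by simp
  next
    case 4
    then have "card F = 3" "F \<subseteq> verts K" "F \<subseteq> verts K'" by (auto simp: faces_of_def)
    moreover from this have "finite F" by (metis card.infinite zero_neq_numeral)
    ultimately show thesis using that[of F] 4 by simp
  qed
qed

text \<open>Coordinates with respect to the common simplex are, extended by zero, coordinates in
  both tetrahedra, and uniqueness identifies them.\<close>

lemma initial_compatible:
  assumes "initial_mesh \<Omega> T0"
  shows "compatible_mesh T0"
proof
  have cm: "conformingly_marked T0"
    using assms by (simp add: initial_mesh_def)
  then have conf: "conforming T0"
    by (simp add: conformingly_marked_def)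
  have mk: "\<forall>K\<in>T0. \<forall>K'\<in>T0. \<forall>F \<in> faces K \<inter> faces K'. mark K F = mark K' F"
    using cm unfolding conformingly_marked_def by (rule conjunct2)
  show pl: "plain K" if "K \<in> T0" for K
    using assms that marked_tetrahedron_plain by (simp add: initial_mesh_def marked_mesh_def)
  have tet: "tetrahedron (verts K)" if "K \<in> T0" for K
    using pl[OF that] by (simp add: plain_def)
  show "l = l'" if K: "K \<in> T0" "K' \<in> T0" "barycentric (verts K) x l" "barycentric (verts K') x l'"
    for K K' x l l'
  proof (cases "K = K'")
    case True
    then show ?thesis using tetrahedron_unique[OF tet[OF K(1)] K(3)] K(4) by simp
  next
    case False
    obtain S where S: "S \<subseteq> verts K" "S \<subseteq> verts K'" "finite S" "card S \<le> 3"
      "body K \<inter> body K' = convex hull S"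
      using conforming_common_simplex[OF conf K(1,2) False] .
    have "x \<in> convex hull S"
      using K(3,4) body_iff[OF tet[OF K(1)]] body_iff[OF tet[OF K(2)]] S(5) by blast
    then obtain l0 where l0: "barycentric S x l0"
      using hull_iff_barycentric[OF S(3)] by blast
    have "l0 = l" "l0 = l'"
      using tetrahedron_unique[OF tet[OF K(1)] barycentric_mono[OF l0 S(1)] K(3)]
        tetrahedron_unique[OF tet[OF K(2)] barycentric_mono[OF l0 S(2)] K(4)]
        tetrahedron_finite[OF tet[OF K(1)]] tetrahedron_finite[OF tet[OF K(2)]] by simp_all
    then show ?thesis by simp
  qed
  show "mark K F = mark K' F" if "K \<in> T0" "K' \<in> T0" "F \<in> faces K" "F \<in> faces K'" for K K' F
    using mk that by blast
  show "K = K'" if K: "K \<in> T0" "K' \<in> T0" "verts K = verts K'" for K K'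
  proof (rule ccontr)
    assume "K \<noteq> K'"
    then obtain S where S: "S \<subseteq> verts K" "S \<subseteq> verts K'" "finite S" "card S \<le> 3"
      "body K \<inter> body K' = convex hull S"
      by (rule conforming_common_simplex[OF conf K(1,2)])
    \<comment> \<open>Distinct elements share at most a face, so some vertex of \<open>K\<close>
      lies outside \<open>S\<close>; with equal vertex sets it would still belong to the
      intersection.\<close>
    have "\<not> verts K \<subseteq> S"
      using card_mono[OF S(3), of "verts K"] S(4) tetrahedron_card[OF tet[OF K(1)]] by linarith
    then obtain y where y: "y \<in> verts K" "y \<notin> S" by blast
    have fin: "finite (verts K)"
      using tetrahedron_finite[OF tet[OF K(1)]] .
    have "y \<in> convex hull S"
      using S(5) K(3) y(1) hull_subset[of "verts K" convex] by (auto simp: body_def)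
    then obtain l0 where l0: "barycentric S y l0"
      using hull_iff_barycentric[OF S(3)] by blast
    have "l0 = (\<lambda>z. if z = y then 1 else 0)"
      using tetrahedron_unique[OF tet[OF K(1)] barycentric_mono[OF l0 S(1) fin] barycentric_vertex[OF y(1) fin]] .
    then show False
      using barycentric_outside[OF l0 y(2)] by simp
  qed
qed

section \<open>Levels of edges\<close>

lemma uniform_core_subset:
  assumes "\<And>K. K \<in> T0 \<Longrightarrow> plain K" "Y \<in> uniform T0 n" "K \<in> uniform {Y} k"
  shows "core K \<subseteq> core Y" "k > 0 \<Longrightarrow> core K \<subset> core Y"
proof -
  have "core K \<subseteq> core Y \<and> (k > 0 \<longrightarrow> core K \<subset> core Y)"
    using assms(3)
  proof (induction k arbitrary: K)
    case (Suc k)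
    then obtain J where J: "J \<in> uniform {Y} k" "K \<in> children J"
      by (auto simp: uniform_Suc)
    have "proper J"
      using uniform_proper[OF assms(1) uniform_addI[OF assms(2) J(1)]] .
    then show ?case
      using core_child_subset J(2) Suc.IH[OF J(1)] by blast
  qed simp
  then show "core K \<subseteq> core Y" "k > 0 \<Longrightarrow> core K \<subset> core Y" by auto
qed

lemma uniform_body_subset:
  assumes "\<And>K. K \<in> T0 \<Longrightarrow> plain K" "Y \<in> uniform T0 n" "K \<in> uniform {Y} k"
  shows "body K \<subseteq> body Y"
  using assms(3)
proof (induction k arbitrary: K)
  case (Suc k)
  then obtain J where J: "J \<in> uniform {Y} k" "K \<in> children J"
    by (auto simp: uniform_Suc)
  have p: "proper J"
    using uniform_proper[OF assms(1) uniform_addI[OF assms(2) J(1)]] .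
  obtain a b where "tetrahedron (verts K)"
    using proper_child[OF p J(2)] by metis
  moreover have "tetrahedron (verts J)"
    using p by (simp add: proper_def)
  ultimately have "body K \<subseteq> body J"
    using barycentric_child[OF p J(2)] body_iff by blast
  then show ?case
    using Suc.IH[OF J(1)] by blast
qed simp

lemma verts_subset_body: "verts K \<subseteq> body K"
  by (simp add: body_def hull_subset)

locale amp_forest =
  fixes T0 :: "marked_tet set"
  assumes base: "compatible_mesh T0"
begin

abbreviation full :: "nat \<Rightarrow> marked_tet set" where
  "full q \<equiv> uniform T0 (3 * q)"

lemma compat: "compatible_mesh (full q)"
  using compatible_uniform[OF base] .

lemma base_plain: "K \<in> T0 \<Longrightarrow> plain K"
  using compatible_mesh.plain[OF base] .

lemma base_cores: "K \<in> T0 \<Longrightarrow> K' \<in> T0 \<Longrightarrow> K \<noteq> K' \<Longrightarrow> core K \<inter> core K' = {}"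
  using compatible_mesh.cores_disjoint[OF base] .

lemma full_Suc: "full (Suc q) = uniform (full q) 3"
proof -
  have "3 * Suc q = 3 * q + 3" by simp
  then show ?thesis using uniform_add by metis
qed

lemma full_SucE:
  assumes "X \<in> full (Suc q)"
  obtains Y where "Y \<in> full q" "X \<in> uniform {Y} 3"
  using assms uniform_UN unfolding full_Suc by blast

lemma full_SucI: "Y \<in> full q \<Longrightarrow> X \<in> uniform {Y} 3 \<Longrightarrow> X \<in> full (Suc q)"
  using uniform_UN unfolding full_Suc by blast

text \<open>If \<open>n < n'\<close>, then \<open>K\<close> would lie strictly inside a node
  \<open>Y\<close> of generation \<open>n\<close>, to which it belongs too; but distinct nodes of
  one generation have disjoint cores.\<close>

lemma generation_unique:
  assumes "K \<in> uniform T0 n" "K \<in> uniform T0 n'"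
  shows "n = n'"
proof -
  have *: False if "K \<in> uniform T0 n" "K \<in> uniform T0 n'" "n < n'" for n n'
  proof -
    have "K \<in> uniform T0 (n + (n' - n))"
      using that by simp
    then obtain Y where Y: "Y \<in> uniform T0 n" "K \<in> uniform {Y} (n' - n)"
      using uniform_addE by blast
    have sub: "core K \<subset> core Y"
      using uniform_core_subset(2)[OF base_plain Y] that(3) by simp
    then have "core K \<inter> core Y = {}"
      using disjoint_cores_uniform[OF base_plain base_cores that(1) Y(1)] by blast
    then show False
      using sub core_nonempty[OF uniform_proper[OF base_plain that(1)]] by blast
  qed
  show ?thesis
    using * assms by (metis nat_neq_iff)
qed

lemma gen_eq:
  assumes "K \<in> uniform T0 n"
  shows "gen T0 K = n"
  unfolding gen_def using assms generation_unique by blast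

lemma descendant_levelE:
  assumes "K \<in> descendants T0"
  obtains X j where "X \<in> full (lvl T0 K)" "K \<in> uniform {X} j" "j < 3"
proof -
  obtain n where n: "K \<in> uniform T0 n"
    using assms by (auto simp: descendants_def)
  then have l: "lvl T0 K = n div 3"
    by (simp add: lvl_def gen_eq)
  obtain X where "X \<in> full (n div 3)" "K \<in> uniform {X} (n mod 3)"
    using uniform_split[OF n] .
  then show thesis
    using that l by simp
qed

lemma reduce_delta:
  assumes "Y \<in> full q" "z \<in> verts Y"
  shows "compatible_mesh.reduce (full q) (\<lambda>y. if y = z then 1 else 0) = (\<lambda>y. if y = z then 1 else 0)"
proof -
  have "{y \<in> vertices (full q). (if y = z then 1 else 0) \<noteq> (0::real)} \<subseteq> {z}"
    by auto
  from card_mono[OF _ this] show ?thesis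
    by (simp add: compatible_mesh.reduce_def[OF compat])
qed

text \<open>A point \<open>z\<close> of \<open>Y\<close> lies in some \<open>X\<close> of the third
  generation and has there the threefold reduction of its coordinates in \<open>Y\<close>. If this
  is nonzero at \<open>z\<close>, then \<open>z\<close> is a vertex of \<open>X\<close>.\<close>

lemma vertices_full_Suc:
  assumes "Y \<in> full q"
  shows "verts Y \<subseteq> vertices (full (Suc q))" "g \<in> edges Y \<Longrightarrow> mid g \<in> vertices (full (Suc q))"
proof -
  interpret U: compatible_mesh "full q" by (rule compat)
  have key: "z \<in> vertices (full (Suc q))"
    if l: "barycentric (verts Y) z l" and r: "U.reduce (U.reduce (U.reduce l)) z \<noteq> 0" for z l
  proof -
    obtain X l' where X: "X \<in> uniform {Y} 3" "barycentric (verts X) z l'"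
      using U.barycentric_third_gen_exists[OF assms l] .
    obtain l0 where l0: "barycentric (verts Y) z l0" "l' = U.reduce (U.reduce (U.reduce l0))"
      using U.barycentric_third_gen[OF assms X] .
    have "l0 = l"
      using tetrahedron_unique[OF U.tet[OF assms] l0(1) l] .
    then have "z \<in> verts X"
      using r l0(2) barycentric_outside[OF X(2), of z] by auto
    then show ?thesis
      using full_SucI[OF assms X(1)] by (auto simp: vertices_def)
  qed
  show "verts Y \<subseteq> vertices (full (Suc q))"
  proof
    fix z assume z: "z \<in> verts Y"
    show "z \<in> vertices (full (Suc q))"
      by (rule key[OF barycentric_vertex[OF z U.fin[OF assms]]]) (simp add: reduce_delta[OF assms z])
  qed
  show "mid g \<in> vertices (full (Suc q))" if g: "g \<in> edges Y"
  proof (rule key[OF barycentric_mid[OF U.edge_sub[OF g] U.edge_card[OF g] U.fin[OF assms]]])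
    let ?h = "\<lambda>y. if y \<in> g then 1 / 2 else (0::real)" and ?d = "\<lambda>y. if y = mid g then 1 else (0::real)"
    have old: "mid g \<notin> vertices (full q)"
      using U.mid_not_old[OF g assms] .
    have gv: "g \<subseteq> vertices (full q)"
      using g assms by (auto simp: edges_of_def vertices_def)
    then have mg: "mid g \<notin> g" using old by blast
    have "{y \<in> vertices (full q). ?h y \<noteq> 0} = g"
      using gv by auto
    \<comment> \<open>A support of two old vertices is itself the edge to be cut, whatever the marks
      are.\<close>
    then have "U.reduce ?h = cut g ?h"
      using U.edge_card[OF g] by (simp add: U.reduce_def U.first_edge_def)
    also have "\<dots> = ?d"
    proof -
      have "g \<noteq> {}"
        using U.edge_card[OF g] by auto
      then have "?h ` g = {1 / 2}"
        by auto
      then show ?thesis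
        using mg by (auto simp: cut_def fun_eq_iff)
    qed
    finally have 1: "U.reduce ?h = ?d" .
    have none: "{y \<in> vertices (full q). ?d y \<noteq> 0} = {}"
      using old by auto
    have 2: "U.reduce ?d = ?d"
      unfolding U.reduce_def Let_def none by simp
    show "U.reduce (U.reduce (U.reduce ?h)) (mid g) \<noteq> 0"
      by (simp add: 1 2)
  qed
qed

lemma vertices_mono: "q \<le> q' \<Longrightarrow> vertices (full q) \<subseteq> vertices (full q')"
proof (induction rule: dec_induct)
  case (step n)
  have "vertices (full n) \<subseteq> vertices (full (Suc n))"
    using vertices_full_Suc(1) by (fastforce simp: vertices_def)
  then show ?case using step by blast
qed simp

text \<open>From level \<open>q + 1\<close> on, the midpoint of \<open>e\<close> is a vertex of
  every uniform mesh, but a mesh in which \<open>e\<close> is an edge does not have it as a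
  vertex.\<close>

lemma edge_level_unique:
  assumes "Y \<in> full q" "e \<in> edges Y" "Z \<in> full q'" "e \<in> edges Z"
  shows "q = q'"
proof -
  have *: False if "Y \<in> full q" "e \<in> edges Y" "Z \<in> full q'" "e \<in> edges Z" "q < q'" for Y Z q q'
  proof -
    have "mid e \<in> vertices (full q')"
      using vertices_full_Suc(2)[OF that(1,2)] vertices_mono[of "Suc q" q'] that(5) by auto
    then show False
      using compatible_mesh.mid_not_old[OF compat that(4,3)] by blast
  qed
  show ?thesis
    using * assms by (metis nat_neq_iff)
qed

text \<open>If \<open>q' \<le> q\<close>, the endpoints of the edge are vertices of the mesh of
  \<open>X\<close> and lie in \<open>X\<close>, so the edge is an edge of \<open>X\<close>;
  uniqueness of its level then forces \<open>q = q'\<close>.\<close>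

lemma level_decreases:
  assumes X: "X \<in> full q" "K \<in> uniform {X} j"
    and X': "X' \<in> full q'" "K' \<in> uniform {X'} j'" "j' < 3"
    and e: "refedge K' \<in> edges K"
  shows "q \<le> q'" "q = q' \<Longrightarrow> refedge K' \<in> edges X"
proof -
  have e': "refedge K' \<in> edges X'"
    using compatible_mesh.refedge_in_edges[OF compat X'] .
  have X_edge: "refedge K' \<in> edges X" if "q' \<le> q"
  proof -
    have "refedge K' \<subseteq> vertices (full q)"
      using e' X'(1) vertices_mono[OF that] by (auto simp: edges_of_def vertices_def)
    moreover have "refedge K' \<subseteq> body X"
      using e verts_subset_body[of K] uniform_body_subset[OF base_plain X] by (auto simp: edges_of_def)
    ultimately have "refedge K' \<subseteq> verts X"
      using compatible_mesh.vertex_in_body[OF compat _ X(1)] by blast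
    then show ?thesis
      using e by (simp add: edges_of_def)
  qed
  show "q \<le> q'"
    using X_edge edge_level_unique[OF X(1) _ X'(1) e'] by (cases "q' \<le> q") auto
  show "refedge K' \<in> edges X" if "q = q'"
    using X_edge that by simp
qed

end

section \<open>Confinement of the bisected edges to vertex stars\<close>

context compatible_mesh
begin

text \<open>All that the analysis of chains uses about the marks of \<open>X\<close>, in a form that
  no longer mentions the coplanarity of those of \<open>Y\<close>.\<close>

lemma third_gen_structure:
  assumes "Y \<in> U" "X \<in> uniform {Y} 3"
  obtains c where "verts X \<inter> vertices U = {c}" "c \<in> verts Y" "c \<in> refedge X" "mid (refedge Y) \<in> verts X"
    "\<And>F. F \<in> faces X \<Longrightarrow> c \<in> F \<Longrightarrow> c \<in> mark X F"
    "\<And>F. F \<in> faces X \<Longrightarrow> c \<notin> F \<Longrightarrow> mid (refedge Y) \<in> mark X F"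
    "\<And>y. y \<in> verts X \<Longrightarrow> y \<noteq> c \<Longrightarrow> \<exists>g\<in>edges Y. y = mid g"
proof -
  obtain w w' t c m n z where T: "third_gen Y X w w' t c m n z"
    using third_gen_uniform[OF plain[OF assms(1)] assms(2)] .
  note f = third_gen_facts[OF assms(1) T]
  have mk: "mark X {c, m, n} = refedge X" "refedge X = {c, m} \<or> refedge X = {c, n}"
    "mark X {c, z, m} = {c, m}" "mark X {c, z, n} = {c, n}"
    "mark X {z, m, n} = {m, n} \<or> mark X {z, m, n} = {z, m}"
    using T by (simp_all add: third_gen_def)
  have fc: "faces X = {{c, z, m}, {c, z, n}, {c, m, n}, {z, m, n}}"
    using faces_of_4[OF f(2)] f(1) by simp
  show thesis
  proof (rule that[of c])
    show "c \<in> refedge X" "mid (refedge Y) \<in> verts X"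
      using mk(2) f(1,3) by auto
    show "c \<in> mark X F" if "F \<in> faces X" "c \<in> F" for F
      using that mk f(2) unfolding fc by auto
    show "mid (refedge Y) \<in> mark X F" if "F \<in> faces X" "c \<notin> F" for F
      using that mk(5) unfolding fc f(3)[symmetric] by auto
    show "\<exists>g\<in>edges Y. y = mid g" if "y \<in> verts X" "y \<noteq> c" for y
      using that f(1,3,4,5,13-15) by auto
  qed (use f in auto)
qed

end

context amp_forest
begin

text \<open>For \<open>j = 0\<close> the refinement edge contains the old vertex of
  \<open>X\<close>. For \<open>j = 1\<close> the edge \<open>e\<close> lies in the inherited face,
  whose mark contains the old vertex if the face does, and otherwise the midpoint of
  \<open>refedge Y\<close>. For \<open>j = 2\<close> only one edge of \<open>K\<close> is an edge of
  \<open>X\<close>, so nothing changes.\<close>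

lemma refedge_step:
  assumes Y: "Y \<in> full q" "X \<in> uniform {Y} 3" and K: "K \<in> uniform {X} j" "j < 3"
    and e: "e \<in> edges X" "e \<in> edges K"
  shows "refedge K = e \<or> (\<exists>c\<in>refedge K. c \<in> vertices (full q)) \<or> mid (refedge Y) \<in> refedge K"
    and "c \<in> e \<Longrightarrow> c \<in> vertices (full q) \<Longrightarrow> c \<in> refedge K"
proof -
  interpret U: compatible_mesh "full q" by (rule compat)
  interpret W: compatible_mesh "full (Suc q)" by (rule compat)
  have X: "X \<in> full (Suc q)"
    using full_SucI[OF Y] .
  obtain o' where o': "verts X \<inter> vertices (full q) = {o'}" "o' \<in> refedge X"
    "\<And>F. F \<in> faces X \<Longrightarrow> o' \<in> F \<Longrightarrow> o' \<in> mark X F"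
    "\<And>F. F \<in> faces X \<Longrightarrow> o' \<notin> F \<Longrightarrow> mid (refedge Y) \<in> mark X F"
    using U.third_gen_structure[OF Y] by metis
  have "(refedge K = e \<or> o' \<in> refedge K \<or> mid (refedge Y) \<in> refedge K) \<and> (o' \<in> e \<longrightarrow> o' \<in> refedge K)"
  proof -
    consider "j = 0" | "j = 1" | "j = 2" using K(2) by linarith
    then show ?thesis
    proof cases
      case 1
      then show ?thesis using K o'(2) by simp
    next
      case 2
      then have "K \<in> children X" using K by simp
      then obtain w w' t m where F: "first_gen X K w w' t m"
        using first_gen_exists[OF W.plain[OF X]] by metis
      note f = W.first_gen_facts[OF X F]
      have "e \<subseteq> verts K \<inter> vertices (full (Suc q))"
        using e X by (auto simp: edges_of_def vertices_def)
      then have "e \<subseteq> {w, w', t}"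
        unfolding f(1) .
      moreover have "refedge K = mark X {w, w', t}"
        using f(2,7) by simp
      ultimately show ?thesis
        using o'(3,4)[OF f(6)] by blast
    next
      case 3
      then obtain J where J: "J \<in> children X" "K \<in> children J"
        using K by (auto simp: uniform_two)
      then obtain u u' t m where F: "first_gen X J u u' t m"
        using first_gen_exists[OF W.plain[OF X]] by metis
      obtain w n where S: "second_gen X K w t m n"
        using second_gen_exists[OF F J(2)] by metis
      note f = W.second_gen_facts[OF X S]
      have "e \<subseteq> verts K \<inter> vertices (full (Suc q))"
        using e X by (auto simp: edges_of_def vertices_def)
      then have "e \<subseteq> refedge K"
        unfolding f(1,2) .
      moreover have "card e = 2" "card (refedge K) = 2"
        using e f(2,3) by (auto simp: edges_of_def)
      moreover have "finite (refedge K)"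
        using f(2) by simp
      ultimately have "refedge K = e"
        using card_subset_eq by metis
      then show ?thesis by simp
    qed
  qed
  moreover have "o' \<in> vertices (full q)"
    using o'(1) by blast
  moreover have "c = o'" if "c \<in> e" "c \<in> vertices (full q)"
    using that o'(1) e(1) by (auto simp: edges_of_def)
  ultimately show "refedge K = e \<or> (\<exists>c\<in>refedge K. c \<in> vertices (full q)) \<or> mid (refedge Y) \<in> refedge K"
    "c \<in> e \<Longrightarrow> c \<in> vertices (full q) \<Longrightarrow> c \<in> refedge K"
    by blast+
qed

definition star :: "nat \<Rightarrow> point \<Rightarrow> marked_tet set" where
  "star q v = {Y \<in> full q. v \<in> verts Y}"

text \<open>Generations 3, 4, 5 below the mesh \<open>full q\<close> are those of level
  \<open>q + 1\<close>.\<close>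

definition near :: "nat \<Rightarrow> point \<Rightarrow> marked_tet set" where
  "near q v = uniform (star q v) 3 \<union> uniform (star q v) 4 \<union> uniform (star q v) 5"

text \<open>Quantified over all \<open>Y\<close> and \<open>X\<close>, since of the ancestors of the
  next event it is only known that \<open>e\<close> is an edge of \<open>X\<close>.\<close>

definition confined :: "nat \<Rightarrow> point \<Rightarrow> point set \<Rightarrow> bool" where
  "confined q v e \<longleftrightarrow> (\<forall>Y\<in>full q. \<forall>X\<in>uniform {Y} 3. e \<subseteq> verts X \<longrightarrow> v \<in> verts Y)"

text \<open>A tetrahedron of \<open>full (Suc q)\<close> has a single vertex in
  \<open>full q\<close>, and \<open>v\<close> is meant to be this one. The index is that of the mesh
  of \<open>v\<close>, one below the mesh whose star is used.\<close>

definition halfway :: "nat \<Rightarrow> point \<Rightarrow> point set \<Rightarrow> bool" where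
  "halfway q v e \<longleftrightarrow> v \<in> vertices (full q) \<and> (\<exists>Y\<in>full (Suc q). \<exists>g\<in>edges Y. v \<in> g \<and> mid g \<in> e)"

definition anchored :: "nat \<Rightarrow> point \<Rightarrow> point set \<Rightarrow> bool" where
  "anchored q v e \<longleftrightarrow> v \<in> vertices (full q) \<and> v \<in> e"

lemma third_gen_in_body: "Y \<in> full q \<Longrightarrow> X \<in> uniform {Y} 3 \<Longrightarrow> verts X \<subseteq> body Y"
  using verts_subset_body uniform_body_subset[OF base_plain] by (metis order_trans)

text \<open>\<open>v\<close> lies in \<open>X\<close> and hence in \<open>Y\<close>, and vertices of
  a uniform mesh do not hang.\<close>

lemma anchored_confined:
  assumes "anchored q v e"
  shows "confined q v e"
  unfolding confined_def
proof (intro ballI impI)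
  fix Y X assume "Y \<in> full q" "X \<in> uniform {Y} 3" "e \<subseteq> verts X"
  then show "v \<in> verts Y"
    using third_gen_in_body[of Y q X] assms compatible_mesh.vertex_in_body[OF compat, of v q Y]
    unfolding anchored_def by blast
qed

lemma mid_confined:
  assumes "Y' \<in> full q" "g \<in> edges Y'" "v \<in> g" "mid g \<in> e"
  shows "confined q v e"
  unfolding confined_def
proof (intro ballI impI)
  fix Y X assume Y: "Y \<in> full q" "X \<in> uniform {Y} 3" "e \<subseteq> verts X"
  then have "mid g \<in> body Y"
    using third_gen_in_body[of Y q X] assms(4) by blast
  then show "v \<in> verts Y"
    using compatible_mesh.mid_in_body[OF compat assms(2,1) Y(1)] assms(3) by blast
qed

lemma halfway_confined: "halfway q v e \<Longrightarrow> confined (Suc q) v e"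
  using mid_confined unfolding halfway_def by metis

lemma confined_near:
  assumes "confined q v e" "Y \<in> full q" "X \<in> uniform {Y} 3" "K \<in> uniform {X} j" "j < 3" "e \<subseteq> verts X"
  shows "K \<in> near q v"
proof -
  have S: "Y \<in> star q v"
    using assms unfolding confined_def star_def by blast
  have "K \<in> uniform (star q v) (3 + j)"
    using uniform_addI[OF uniform_addI[OF _ assms(3)] assms(4), of "star q v" 0] S by simp
  moreover have "j = 0 \<or> j = 1 \<or> j = 2" using assms(5) by linarith
  ultimately show ?thesis
    by (auto simp: near_def)
qed

lemma confined_start:
  assumes "Y \<in> full q" "X \<in> uniform {Y} 3" "e \<in> edges X"
  obtains v where "confined q v e"
proof -
  interpret U: compatible_mesh "full q" by (rule compat)
  obtain c where c: "verts X \<inter> vertices (full q) = {c}"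
    "\<And>y. y \<in> verts X \<Longrightarrow> y \<noteq> c \<Longrightarrow> \<exists>g\<in>edges Y. y = mid g"
    using U.third_gen_structure[OF assms(1,2)] by metis
  obtain x where x: "x \<in> e" "x \<in> verts X"
    using assms(3) by (auto simp: edges_of_def card_2_iff)
  show thesis
  proof (cases "x = c")
    case True
    then have "anchored q x e"
      using c(1) x by (auto simp: anchored_def)
    then show thesis
      using anchored_confined that by blast
  next
    case False
    then obtain g where g: "g \<in> edges Y" "x = mid g"
      using c(2) x by blast
    then obtain v where "v \<in> g"
      by (auto simp: edges_of_def card_2_iff)
    then show thesis
      using mid_confined[OF assms(1) g(1)] g(2) x(1) that by blast
  qed
qed

lemma new_state:
  assumes Y: "Y \<in> full (Suc q)" "X \<in> uniform {Y} 3" and K: "K \<in> uniform {X} j" "j < 3"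
    and e: "e \<in> edges X" "e \<in> edges K"
  obtains "refedge K = e" | v where "halfway q v (refedge K)" "v \<in> verts Y" | v where "anchored (Suc q) v (refedge K)"
proof -
  have "refedge K = e \<or> (\<exists>c\<in>refedge K. c \<in> vertices (full (Suc q))) \<or> mid (refedge Y) \<in> refedge K"
    using refedge_step(1)[OF assms] .
  then consider "refedge K = e" | c where "c \<in> refedge K" "c \<in> vertices (full (Suc q))"
    | "mid (refedge Y) \<in> refedge K" by blast
  then show thesis
  proof cases
    case 3
    obtain Z where Z: "Z \<in> full q" "Y \<in> uniform {Z} 3"
      using full_SucE[OF Y(1)] .
    \<comment> \<open>Applied one level higher, the structure of the third generation says that
      \<open>refedge Y\<close> starts at the only vertex of \<open>Y\<close> in
      \<open>full q\<close>.\<close>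
    obtain v where v: "verts Y \<inter> vertices (full q) = {v}" "v \<in> refedge Y"
      using compatible_mesh.third_gen_structure[OF compat Z] by metis
    have "refedge Y \<in> edges Y"
      using compatible_mesh.plain[OF compat Y(1)] by (simp add: plain_def)
    then have "halfway q v (refedge K)"
      using 3 v Y(1) unfolding halfway_def by blast
    then show thesis using that(2) v(1) by blast
  qed (use that in \<open>auto simp: anchored_def\<close>)
qed

text \<open>The star cannot change in this state: \<open>e\<close> forces \<open>v\<close> to be a
  vertex of \<open>Y\<close>, a new halfway edge comes with a vertex \<open>v'\<close> of the same
  \<open>Y\<close>, and \<open>Y\<close> has only one vertex in \<open>full q\<close>.\<close>

lemma halfway_step:
  assumes h: "halfway q v e"
    and Y: "Y \<in> full (Suc q)" "X \<in> uniform {Y} 3" and K: "K \<in> uniform {X} j" "j < 3"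
    and e: "e \<in> edges X" "e \<in> edges K"
  shows "halfway q v (refedge K) \<or> (\<exists>v'. anchored (Suc q) v' (refedge K))"
proof (cases rule: new_state[OF Y K e])
  case 1
  then show ?thesis using h by simp
next
  case (2 v')
  have "v \<in> verts Y"
    using halfway_confined[OF h] Y e(1) unfolding confined_def by (auto simp: edges_of_def)
  moreover have "v \<in> vertices (full q)" "v' \<in> vertices (full q)"
    using h 2 by (auto simp: halfway_def)
  ultimately have "{v, v'} \<subseteq> verts Y \<inter> vertices (full q)"
    using 2(2) by blast
  moreover obtain Z where Z: "Z \<in> full q" "Y \<in> uniform {Z} 3"
    using full_SucE[OF Y(1)] .
  obtain o' where "verts Y \<inter> vertices (full q) = {o'}"
    using compatible_mesh.third_gen_structure[OF compat Z] by metis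
  ultimately have "v = v'" by simp
  then show ?thesis using 2 by simp
next
  case (3 v')
  then show ?thesis by blast
qed

lemma anchored_step:
  assumes "anchored q v e"
    and Y: "Y \<in> full q" "X \<in> uniform {Y} 3" and K: "K \<in> uniform {X} j" "j < 3"
    and e: "e \<in> edges X" "e \<in> edges K"
  shows "anchored q v (refedge K)"
  using refedge_step(2)[OF Y K e] assms(1) by (auto simp: anchored_def)

section \<open>Counting the descendants of a star\<close>

lemma card_children:
  assumes "proper K"
  shows "finite (children K)" "card (children K) \<le> 2"
proof -
  have "card (refedge K) = 2"
    using assms by (simp add: proper_def edges_of_def)
  then have "finite (refedge K)"
    by (metis card.infinite zero_neq_numeral)
  then show "finite (children K)" "card (children K) \<le> 2"
    using card_image_le[of "refedge K" "child K"] \<open>card (refedge K) = 2\<close> by (auto simp: children_def)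
qed

lemma card_uniform:
  assumes "finite S" "S \<subseteq> uniform T0 n"
  shows "finite (uniform S k) \<and> card (uniform S k) \<le> 2 ^ k * card S"
proof (induction k)
  case (Suc k)
  have p: "proper K" if "K \<in> uniform S k" for K
  proof -
    obtain Y where "Y \<in> S" "K \<in> uniform {Y} k"
      using \<open>K \<in> uniform S k\<close> uniform_UN by blast
    then show ?thesis
      using uniform_proper[OF base_plain uniform_addI] assms(2) by blast
  qed
  have "card (uniform S (Suc k)) \<le> (\<Sum>K\<in>uniform S k. card (children K))"
    unfolding uniform_Suc using Suc by (intro card_UN_le) simp
  also have "\<dots> \<le> (\<Sum>K\<in>uniform S k. 2)"
    using p card_children by (intro sum_mono) simp
  also have "\<dots> = 2 * card (uniform S k)" by simp
  also have "\<dots> \<le> 2 ^ Suc k * card S"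
    using Suc by simp
  finally show ?case
    using Suc p card_children(1) by (simp add: uniform_Suc)
qed (use assms in simp)

lemma card_near:
  assumes "finite T0"
  shows "finite (near q v)" "card (near q v) \<le> 56 * card (star q v)"
proof -
  have "finite (full q)"
    using card_uniform[OF assms, of 0 "3 * q"] by simp
  then have S: "finite (star q v)" "star q v \<subseteq> uniform T0 (3 * q)"
    by (auto simp: star_def)
  note c = card_uniform[OF S]
  show "finite (near q v)"
    using c by (simp add: near_def)
  have "card (near q v) \<le> card (uniform (star q v) 3) + card (uniform (star q v) 4) + card (uniform (star q v) 5)"
    unfolding near_def by (meson add_le_mono1 card_Un_le order_trans)
  also have "\<dots> \<le> 8 * card (star q v) + 16 * card (star q v) + 32 * card (star q v)"
    using c[of 3] c[of 4] c[of 5] by simp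
  finally show "card (near q v) \<le> 56 * card (star q v)" by simp
qed

lemma card_star_nu: "enat (card (star q v)) \<le> nu T0"
proof (cases "v \<in> vertices (full q)")
  case True
  have "enat (card (star q v)) \<le> (SUP z \<in> vertices (full q). enat (card {K \<in> full q. z \<in> verts K}))"
    unfolding star_def using True by (rule SUP_upper)
  also have "\<dots> \<le> nu T0"
    unfolding nu_def by (rule SUP_upper) simp
  finally show ?thesis .
next
  case False
  then have "star q v = {}"
    by (auto simp: star_def vertices_def)
  then show ?thesis
    by (simp add: zero_enat_def[symmetric])
qed

end

section \<open>Causal chains\<close>

context amp_forest
begin

text \<open>Preserved when any part of the mesh is bisected simultaneously, hence available for
  every mesh of the call; it keeps bisected tetrahedra from coming back.\<close>

definition separated :: "marked_tet set \<Rightarrow> bool" where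
  "separated T \<longleftrightarrow> T \<subseteq> descendants T0 \<and>
     (\<forall>K\<in>T. \<forall>K'\<in>T. K \<noteq> K' \<longrightarrow> core K \<inter> core K' = {})"

lemma descendant_proper: "K \<in> descendants T0 \<Longrightarrow> proper K"
  using uniform_proper[OF base_plain] by (auto simp: descendants_def)

lemma children_descendants:
  assumes "K \<in> descendants T0" "J \<in> children K"
  shows "J \<in> descendants T0" "gen T0 J = Suc (gen T0 K)"
proof -
  obtain n where n: "K \<in> uniform T0 n"
    using assms(1) by (auto simp: descendants_def)
  then have J: "J \<in> uniform T0 (Suc n)"
    using assms(2) by (auto simp: uniform_Suc)
  then show "J \<in> descendants T0"
    unfolding descendants_def by blast
  show "gen T0 J = Suc (gen T0 K)"
    using gen_eq[OF n] gen_eq[OF J] by simp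
qed

lemma lvl_child: "K \<in> descendants T0 \<Longrightarrow> J \<in> children K \<Longrightarrow> lvl T0 J \<le> lvl T0 K + 1"
  by (simp add: lvl_def children_descendants(2))

lemma core_children_subset: "K \<in> descendants T0 \<Longrightarrow> J \<in> children K \<Longrightarrow> core J \<subset> core K"
  using core_child_subset descendant_proper by blast

lemma separated_base: "separated T0"
  unfolding separated_def descendants_def
  using base_cores uniform.simps(1)[of T0] by blast

lemma bisectE:
  assumes "J \<in> bisect T B"
  obtains "J \<in> T" "J \<notin> B" | P where "P \<in> B" "J \<in> children P"
  using assms by (auto simp: bisect_def)

lemma separated_bisect:
  assumes "separated T" "B \<subseteq> T"
  shows "separated (bisect T B)"
  unfolding separated_def
proof (intro conjI ballI impI)
  have D: "T \<subseteq> descendants T0"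
    using assms(1) by (simp add: separated_def)
  show "bisect T B \<subseteq> descendants T0"
    using D assms(2) children_descendants(1) by (auto simp: bisect_def)
  have sep: "core K \<inter> core K' = {}" if "K \<in> T" "K' \<in> T" "K \<noteq> K'" for K K'
    using assms(1) that by (simp add: separated_def)
  fix J J' assume J: "J \<in> bisect T B" "J' \<in> bisect T B" "J \<noteq> J'"
  have par: "\<exists>P\<in>T. core L \<subseteq> core P \<and> (if P \<in> B then L \<in> children P else L = P)" if "L \<in> bisect T B" for L
    using that
  proof (cases rule: bisectE)
    case (2 P)
    then have "P \<in> T" using assms(2) by blast
    moreover from this have "core L \<subseteq> core P"
      using core_children_subset[of P L] D 2 by blast
    ultimately show ?thesis using 2 by auto
  qed auto
  obtain P P' where P: "P \<in> T" "core J \<subseteq> core P" "if P \<in> B then J \<in> children P else J = P"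
    and P': "P' \<in> T" "core J' \<subseteq> core P'" "if P' \<in> B then J' \<in> children P' else J' = P'"
    using par[OF J(1)] par[OF J(2)] by blast
  show "core J \<inter> core J' = {}"
  proof (cases "P = P'")
    case True
    then have "J \<in> children P" "J' \<in> children P"
      using P(3) P'(3) J(3) by (auto split: if_splits)
    then show ?thesis
      using core_children_disjoint[OF descendant_proper] P(1) D J(3) by blast
  next
    case False
    then show ?thesis
      using sep[OF P(1) P'(1)] P(2) P'(2) by blast
  qed
qed

lemma separated_descendant_mesh: "descendant_mesh T0 T \<Longrightarrow> separated T"
  by (induction rule: descendant_mesh.induct) (simp_all add: separated_base separated_bisect)

end

locale amp_call = amp_forest +
  fixes T M :: "marked_tet set"
  assumes sep: "separated T" and marked: "M \<subseteq> T"
begin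

lemma call_Suc: "call_mesh T M (Suc n) = bisect (call_mesh T M n) (batch T M n)"
  by (simp add: batch_def)

lemma batch_subset: "batch T M n \<subseteq> call_mesh T M n"
  using marked by (auto simp: batch_def hanging_elements_def)

lemma call_separated: "separated (call_mesh T M n)"
proof (induction n)
  case (Suc n)
  show ?case
    unfolding call_Suc using separated_bisect[OF Suc batch_subset] .
qed (simp add: sep)

lemma call_descendants: "K \<in> call_mesh T M n \<Longrightarrow> K \<in> descendants T0"
  using call_separated by (auto simp: separated_def)

text \<open>Elements are only ever replaced by smaller ones, so whatever meets the core of
  \<open>K\<close> after its batch is a proper part of it.\<close>

lemma batch_removed:
  assumes K: "K \<in> batch T M n" and J: "J \<in> call_mesh T M (Suc n + k)"
  shows "core J \<inter> core K = {} \<or> core J \<subset> core K"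
  using J
proof (induction k arbitrary: J)
  case 0
  have "J \<in> bisect (call_mesh T M n) (batch T M n)"
    using 0 call_Suc by simp
  then show ?case
  proof (cases rule: bisectE)
    case 1
    then have "J \<noteq> K" using K by blast
    moreover have "K \<in> call_mesh T M n"
      using K batch_subset by blast
    ultimately show ?thesis
      using call_separated[of n] 1(1) by (simp add: separated_def)
  next
    case (2 P)
    have P: "P \<in> call_mesh T M n" "K \<in> call_mesh T M n"
      using 2 K batch_subset by auto
    have sub: "core J \<subset> core P"
      using core_children_subset[OF call_descendants[OF P(1)] 2(2)] .
    show ?thesis
    proof (cases "P = K")
      case False
      then have "core P \<inter> core K = {}"
        using call_separated[of n] P by (simp add: separated_def)
      then show ?thesis using sub by blast
    qed (use sub in simp)
  qed
next
  case (Suc k)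
  have "J \<in> bisect (call_mesh T M (Suc n + k)) (batch T M (Suc n + k))"
    using Suc.prems call_Suc[of "Suc n + k"] by simp
  then show ?case
  proof (cases rule: bisectE)
    case 1
    then show ?thesis using Suc.IH by blast
  next
    case (2 P)
    have P: "P \<in> call_mesh T M (Suc n + k)"
      using 2(1) batch_subset by blast
    have "core J \<subset> core P"
      using core_children_subset[OF call_descendants[OF P] 2(2)] .
    then show ?thesis
      using Suc.IH[OF P] by blast
  qed
qed

lemma batch_unique:
  assumes "K \<in> batch T M n" "K \<in> batch T M n'"
  shows "n = n'"
proof -
  have *: False if "K \<in> batch T M n" "K \<in> batch T M n'" "n < n'" for n n'
  proof -
    have "K \<in> call_mesh T M (Suc n + (n' - Suc n))"
      using that batch_subset by auto
    from batch_removed[OF that(1) this] show False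
      using core_nonempty[OF descendant_proper[OF call_descendants]] batch_subset that(1) by blast
  qed
  show ?thesis
    using * assms by (metis nat_neq_iff)
qed

lemma new_element_parent:
  assumes "J \<in> call_mesh T M n" "J \<notin> T"
  shows "\<exists>k. \<exists>K\<in>batch T M k. J \<in> children K"
  using assms(1)
proof (induction n)
  case (Suc n)
  then have "J \<in> bisect (call_mesh T M n) (batch T M n)"
    using call_Suc by simp
  then show ?case
    using Suc.IH by (cases rule: bisectE) blast+
qed (use assms(2) in simp)

section \<open>Following the events of one level along a chain\<close>

definition level_events :: "marked_tet set \<Rightarrow> nat \<Rightarrow> marked_tet set" where
  "level_events E q = {L \<in> E. lvl T0 L = q}"

definition covered :: "nat \<Rightarrow> marked_tet set \<Rightarrow> bool" where
  "covered q E \<longleftrightarrow> (\<exists>u v w. E \<subseteq> near q u \<union> near q v \<union> near q w)"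

text \<open>The three phases on level \<open>q + 2\<close>: \<open>E\<close> are its events so far
  and \<open>e\<close> is the edge bisected last. Each disjunct names the stars used and the state
  that locates the next event; a change of phase adds at most one star.\<close>

definition tracked :: "nat \<Rightarrow> marked_tet set \<Rightarrow> point set \<Rightarrow> bool" where
  "tracked q E e \<longleftrightarrow>
     (\<exists>u. E \<subseteq> near (Suc q) u \<and> confined (Suc q) u e) \<or>
     (\<exists>u v. E \<subseteq> near (Suc q) u \<union> near (Suc q) v \<and> halfway q v e) \<or>
     (\<exists>u v w. E \<subseteq> near (Suc q) u \<union> near (Suc q) v \<union> near (Suc q) w \<and> anchored (Suc q) w e)"

lemma tracked_covered:
  assumes "tracked q E e"
  shows "covered (Suc q) E"
  using assms unfolding tracked_def covered_def by (metis sup.idem sup_assoc)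

lemma tracked_start:
  assumes "Y \<in> full (Suc q)" "X \<in> uniform {Y} 3" "K \<in> uniform {X} j" "j < 3"
  shows "tracked q {K} (refedge K)"
proof -
  have "refedge K \<in> edges X"
    using compatible_mesh.refedge_in_edges[OF compat full_SucI[OF assms(1,2)] assms(3,4)] .
  moreover from confined_start[OF assms(1,2) this] obtain v where "confined (Suc q) v (refedge K)" .
  ultimately have "K \<in> near (Suc q) v" "confined (Suc q) v (refedge K)"
    using confined_near[OF _ assms] by (auto simp: edges_of_def)
  then show ?thesis
    unfolding tracked_def by blast
qed

lemma tracked_step:
  assumes t: "tracked q E e"
    and Y: "Y \<in> full (Suc q)" "X \<in> uniform {Y} 3" and K: "K \<in> uniform {X} j" "j < 3"
    and e: "e \<in> edges X" "e \<in> edges K"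
  shows "tracked q (insert K E) (refedge K)"
proof -
  have sub: "e \<subseteq> verts X"
    using e(1) by (simp add: edges_of_def)
  \<comment> \<open>\<open>K\<close> is located by the edge bisected before it; the state of its own
    refinement edge matters only for its successor.\<close>
  have nr: "K \<in> near (Suc q) v" if "confined (Suc q) v e" for v
    using confined_near[OF that Y K sub] .
  consider (c) u where "E \<subseteq> near (Suc q) u" "confined (Suc q) u e"
    | (h) u v where "E \<subseteq> near (Suc q) u \<union> near (Suc q) v" "halfway q v e"
    | (a) u v w where "E \<subseteq> near (Suc q) u \<union> near (Suc q) v \<union> near (Suc q) w" "anchored (Suc q) w e"
    using t unfolding tracked_def by blast
  then show ?thesis
  proof cases
    case c
    have E: "insert K E \<subseteq> near (Suc q) u"
      using c nr by simp
    show ?thesis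
    proof (cases rule: new_state[OF Y K e])
      case 1
      then show ?thesis using E c(2) unfolding tracked_def by auto
    next
      case (2 v)
      then show ?thesis using E unfolding tracked_def by blast
    next
      case (3 w)
      then show ?thesis using E unfolding tracked_def by blast
    qed
  next
    case h
    have E: "insert K E \<subseteq> near (Suc q) u \<union> near (Suc q) v"
      using h nr[OF halfway_confined] by simp
    show ?thesis
      using halfway_step[OF h(2) Y K e] E unfolding tracked_def by blast
  next
    case a
    have E: "insert K E \<subseteq> near (Suc q) u \<union> near (Suc q) v \<union> near (Suc q) w"
      using a nr[OF anchored_confined] by simp
    show ?thesis
      using anchored_step[OF a(2) Y K e] E unfolding tracked_def by blast
  qed
qed

text \<open>What is carried along the chain from \<open>R\<close> to \<open>K\<close>, with its
  events collected in \<open>E\<close>. The batch numbers ensure that the next event is new;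
  \<open>covered\<close> keeps the result for every level, while \<open>tracked\<close> concerns
  only the level of \<open>K\<close>, where counting is in progress.\<close>

definition history :: "(marked_tet \<Rightarrow> marked_tet) \<Rightarrow> marked_tet \<Rightarrow> marked_tet set \<Rightarrow> marked_tet \<Rightarrow> bool" where
  "history par R E K \<longleftrightarrow>
     R \<in> M \<and> R \<in> E \<and> K \<in> E \<and> finite E \<and> E \<subseteq> descendants T0 \<and> causal_chain T M par R K \<and>
     (\<forall>L\<in>E. lvl T0 K \<le> lvl T0 L) \<and>
     (\<forall>L\<in>E. \<exists>i j. i \<le> j \<and> L \<in> batch T M i \<and> K \<in> batch T M j) \<and>
     (\<forall>x\<in>body K. \<exists>y\<in>body R. dist x y \<le> (\<Sum>L\<in>E. diameter (body L))) \<and>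
     (\<forall>r. covered (Suc r) (level_events E (r + 2))) \<and>
     (\<forall>r. lvl T0 K = r + 2 \<longrightarrow> tracked r (level_events E (r + 2)) (refedge K))"

lemma body_bounded: "K \<in> descendants T0 \<Longrightarrow> bounded (body K)"
  using descendant_proper tetrahedron_finite
  by (auto simp: body_def proper_def intro: finite_imp_bounded_convex_hull)

lemma level_2E:
  assumes "K \<in> descendants T0" "lvl T0 K = r + 2"
  obtains Y X j where "Y \<in> full (Suc r)" "X \<in> uniform {Y} 3" "K \<in> uniform {X} j" "j < 3"
proof -
  obtain X j where X: "X \<in> full (lvl T0 K)" "K \<in> uniform {X} j" "j < 3"
    using descendant_levelE[OF assms(1)] .
  then have "X \<in> full (Suc (Suc r))"
    using assms(2) by simp
  then obtain Y where "Y \<in> full (Suc r)" "X \<in> uniform {Y} 3"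
    by (rule full_SucE)
  then show thesis using that X by blast
qed

lemma history_root:
  assumes "R \<in> M"
  shows "history par R {R} R"
proof -
  have b: "R \<in> batch T M 0"
    using assms by (simp add: batch_def)
  have D: "R \<in> descendants T0"
    using call_descendants[of R 0] assms marked by auto
  have tr: "tracked r (level_events {R} (r + 2)) (refedge R)" if lv: "lvl T0 R = r + 2" for r
  proof -
    have "level_events {R} (r + 2) = {R}"
      using lv by (auto simp: level_events_def)
    then show ?thesis
      using level_2E[OF D lv] tracked_start by metis
  qed
  have "covered (Suc r) (level_events {R} (r + 2))" for r
  proof (cases "lvl T0 R = r + 2")
    case True
    then show ?thesis using tr tracked_covered by blast
  next
    case False
    then have "level_events {R} (r + 2) = {}"
      by (auto simp: level_events_def)
    then show ?thesis by (simp add: covered_def)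
  qed
  then show ?thesis
    using assms b D tr diameter_ge_0[OF body_bounded[OF D]]
    unfolding history_def by (auto simp: causal_chain_def intro!: bexI)
qed

lemma history_step:
  assumes H: "history par R E K'" and ce: "causal_edge T M par K' K"
    and pp: "possible_parent T M K' K"
  shows "history par R (insert K E) K"
proof -
  have h: "R \<in> M" "R \<in> E" "K' \<in> E" "finite E" "E \<subseteq> descendants T0" "causal_chain T M par R K'"
    "\<And>L. L \<in> E \<Longrightarrow> lvl T0 K' \<le> lvl T0 L"
    "\<And>L. L \<in> E \<Longrightarrow> \<exists>i j. i \<le> j \<and> L \<in> batch T M i \<and> K' \<in> batch T M j"
    "\<And>x. x \<in> body K' \<Longrightarrow> \<exists>y\<in>body R. dist x y \<le> (\<Sum>L\<in>E. diameter (body L))"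
    "\<And>r. covered (Suc r) (level_events E (r + 2))"
    "\<And>r. lvl T0 K' = r + 2 \<Longrightarrow> tracked r (level_events E (r + 2)) (refedge K')"
    using H unfolding history_def by blast+
  obtain n n' where n: "n' < n" "K \<in> batch T M n" "K' \<in> batch T M n'" "refedge K' \<in> edges K"
    using pp by (auto simp: possible_parent_def)
  have D: "K \<in> descendants T0" "K' \<in> descendants T0"
    using call_descendants batch_subset n(2,3) by blast+
  have idx: "\<exists>i. i \<le> n' \<and> L \<in> batch T M i" if "L \<in> E" for L
    using h(8)[OF that] batch_unique[OF n(3)] by blast
  \<comment> \<open>An event has only one batch number, and that of \<open>K\<close> exceeds all
    those in \<open>E\<close>.\<close>
  then have new: "K \<notin> E"
    using batch_unique[OF n(2)] n(1) by fastforce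
  obtain X j where X: "X \<in> full (lvl T0 K)" "K \<in> uniform {X} j" "j < 3"
    using descendant_levelE[OF D(1)] .
  obtain X' j' where X': "X' \<in> full (lvl T0 K')" "K' \<in> uniform {X'} j'" "j' < 3"
    using descendant_levelE[OF D(2)] .
  note lev = level_decreases[OF X(1,2) X' n(4)]
  have tr: "tracked r (level_events (insert K E) (r + 2)) (refedge K)" if lv: "lvl T0 K = r + 2" for r
  proof -
    obtain Y Z i where Y: "Y \<in> full (Suc r)" "Z \<in> uniform {Y} 3" "K \<in> uniform {Z} i" "i < 3"
      using level_2E[OF D(1) lv] .
    have ins: "level_events (insert K E) (r + 2) = insert K (level_events E (r + 2))"
      using lv by (auto simp: level_events_def)
    show ?thesis
    proof (cases "lvl T0 K' = r + 2")
      case True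
      have Z: "Z \<in> full (lvl T0 K)"
        using full_SucI[OF Y(1,2)] lv by simp
      have "refedge K' \<in> edges Z"
        using level_decreases(2)[OF Z Y(3) X' n(4)] True lv by simp
      then show ?thesis
        unfolding ins using tracked_step[OF h(11)[OF True] Y _ n(4)] by simp
    next
      case False
      \<comment> \<open>Levels never increase along the chain, so \<open>K\<close> is the first
        event on its level and tracking starts afresh.\<close>
      then have "r + 2 < lvl T0 K'"
        using lev(1) lv by simp
      then have "level_events E (r + 2) = {}"
        using h(7) by (force simp: level_events_def)
      then show ?thesis
        unfolding ins using tracked_start[OF Y] by simp
    qed
  qed
  have cov: "covered (Suc r) (level_events (insert K E) (r + 2))" for r
  proof (cases "lvl T0 K = r + 2")
    case True
    then show ?thesis using tr tracked_covered by blast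
  next
    case False
    then have "level_events (insert K E) (r + 2) = level_events E (r + 2)"
      by (auto simp: level_events_def)
    then show ?thesis using h(10) by simp
  qed
  have dst: "\<exists>y\<in>body R. dist x y \<le> (\<Sum>L\<in>insert K E. diameter (body L))" if x: "x \<in> body K" for x
  proof -
    have e': "refedge K' \<in> edges K'"
      using descendant_proper[OF D(2)] by (simp add: proper_def)
    \<comment> \<open>Consecutive events share the endpoints of the bisected edge, so each step adds
      at most one diameter.\<close>
    obtain z where "z \<in> refedge K'"
      using n(4) by (auto simp: edges_of_def card_2_iff)
    then have z: "z \<in> body K" "z \<in> body K'"
      using n(4) e' verts_subset_body by (auto simp: edges_of_def)
    obtain y where y: "y \<in> body R" "dist z y \<le> (\<Sum>L\<in>E. diameter (body L))"
      using h(9)[OF z(2)] by blast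
    have "dist x z \<le> diameter (body K)"
      using diameter_bounded_bound[OF body_bounded[OF D(1)] x z(1)] .
    then have "dist x y \<le> (\<Sum>L\<in>insert K E. diameter (body L))"
      using y(2) dist_triangle[of x y z] new h(4) by simp
    then show ?thesis using y(1) by blast
  qed
  have ch: "causal_chain T M par R K"
    using h(6) ce unfolding causal_chain_def by (rule rtranclp.rtrancl_into_rtrancl)
  have "lvl T0 K \<le> lvl T0 L" if "L \<in> insert K E" for L
    using that h(7) lev(1) by (auto intro: order_trans)
  moreover have "\<exists>i j. i \<le> j \<and> L \<in> batch T M i \<and> K \<in> batch T M j" if "L \<in> insert K E" for L
  proof (cases "L = K")
    case True
    then show ?thesis using n(2) by blast
  next
    case False
    then show ?thesis
      using that idx[of L] n(1,2) by (metis insertE le_trans less_imp_le_nat)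
  qed
  ultimately show ?thesis
    unfolding history_def using h(1-5) D(1) ch dst cov tr by simp
qed

text \<open>Parents belong to earlier batches, so following \<open>par\<close> ends at a root;
  uniqueness of the batch relates the batch numbers in \<open>possible_parent\<close> to
  \<open>n\<close>.\<close>

lemma history_exists:
  assumes "causal_forest T M par" "K \<in> batch T M n"
  shows "\<exists>R E. history par R E K"
  using assms(2)
proof (induction n arbitrary: K rule: less_induct)
  case (less n)
  show ?case
  proof (cases "K \<in> M")
    case True
    then show ?thesis using history_root by blast
  next
    case False
    have K: "K \<in> events T M - M"
      using less.prems False by (auto simp: events_def)
    then have pp: "possible_parent T M (par K) K"
      using assms(1) by (simp add: causal_forest_def)
    then obtain n' where "n' < n" "par K \<in> batch T M n'"
      using batch_unique[OF less.prems] by (auto simp: possible_parent_def)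
    then obtain R E where "history par R E (par K)"
      using less.IH by blast
    then show ?thesis
      using history_step[OF _ _ pp] K unfolding causal_edge_def by blast
  qed
qed

end

text \<open>Shifted down by \<open>l\<close>, the exponents are distinct terms of the full geometric
  series, whose sum is 2.\<close>

lemma sum_geometric_le:
  fixes A :: "nat set"
  assumes "finite A" "\<And>q. q \<in> A \<Longrightarrow> l \<le> q"
  shows "(\<Sum>q\<in>A. (1 / 2 :: real) ^ q) \<le> 2 * (1 / 2) ^ l"
proof -
  have "summable (\<lambda>i. (1 / 2 :: real) ^ i)"
    by (rule summable_geometric) simp
  moreover have "inj_on (\<lambda>q. q - l) A"
    using assms(2) by (auto simp: inj_on_def) (metis le_add_diff_inverse)
  ultimately have "(\<Sum>i\<in>(\<lambda>q. q - l) ` A. (1 / 2 :: real) ^ i) \<le> (\<Sum>i. (1 / 2) ^ i)"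
    using assms(1) by (intro sum_le_suminf) auto
  also have "\<dots> = 2"
    by (subst suminf_geometric) auto
  finally have "(\<Sum>q\<in>A. (1 / 2 :: real) ^ (q - l)) \<le> 2"
    using \<open>inj_on (\<lambda>q. q - l) A\<close> by (simp add: sum.reindex)
  then have "(1 / 2) ^ l * (\<Sum>q\<in>A. (1 / 2 :: real) ^ (q - l)) \<le> (1 / 2) ^ l * 2"
    by (intro mult_left_mono) auto
  moreover have "(1 / 2) ^ l * (\<Sum>q\<in>A. (1 / 2 :: real) ^ (q - l)) = (\<Sum>q\<in>A. (1 / 2) ^ q)"
    unfolding sum_distrib_left using assms(2)
    by (intro sum.cong) (auto simp: power_add[symmetric])
  ultimately show ?thesis by simp
qed

lemma powi_neg_eq: "(2 :: real) powi (- int n) = (1 / 2) ^ n"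
  by (simp add: power_int_minus power_one_over field_simps)

section \<open>Counting events and summing diameters over the levels\<close>

context amp_forest
begin

lemma level_subset:
  assumes "E \<subseteq> descendants T0"
  shows "{L \<in> E. lvl T0 L = q} \<subseteq> uniform T0 (3 * q) \<union> uniform T0 (3 * q + 1) \<union> uniform T0 (3 * q + 2)"
proof
  fix L assume "L \<in> {L \<in> E. lvl T0 L = q}"
  then have L: "L \<in> descendants T0" "lvl T0 L = q"
    using assms by auto
  obtain X j where X: "X \<in> full q" "L \<in> uniform {X} j" "j < 3"
    using descendant_levelE[OF L(1)] L(2) by metis
  then have "L \<in> uniform T0 (3 * q + j)"
    using uniform_addI by blast
  moreover have "j = 0 \<or> j = 1 \<or> j = 2" using X(3) by linarith
  ultimately show "L \<in> uniform T0 (3 * q) \<union> uniform T0 (3 * q + 1) \<union> uniform T0 (3 * q + 2)"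
    by auto
qed

lemma card_low_level:
  assumes "finite T0" "E \<subseteq> descendants T0" "q < 2"
  shows "card {L \<in> E. lvl T0 L = q} \<le> 56 * card T0"
proof -
  note c = card_uniform[OF assms(1), of 0, simplified]
  have "card {L \<in> E. lvl T0 L = q}
      \<le> card (uniform T0 (3 * q) \<union> uniform T0 (3 * q + 1) \<union> uniform T0 (3 * q + 2))"
    using c by (intro card_mono level_subset[OF assms(2)]) auto
  also have "\<dots> \<le> card (uniform T0 (3 * q)) + card (uniform T0 (3 * q + 1)) + card (uniform T0 (3 * q + 2))"
    by (meson add_le_mono1 card_Un_le order_trans)
  also have "\<dots> \<le> 2 ^ (3 * q) * card T0 + 2 ^ (3 * q + 1) * card T0 + 2 ^ (3 * q + 2) * card T0"
    using c by (intro add_mono) blast+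
  also have "\<dots> \<le> 56 * card T0"
    using assms(3) by (cases "q = 0") (auto simp: less_2_cases_iff)
  finally show ?thesis .
qed

end

context amp_call
begin

text \<open>The split at 2 comes from the state \<open>halfway\<close>, which refers to a uniform
  mesh two levels coarser.\<close>

lemma card_level_events:
  assumes fin: "finite T0" and H: "history par R E K" and nu: "nu T0 = enat N"
  shows "real (card (level_events E q)) \<le> max (448 * real (card T0)) (630 * real N)"
proof (cases "q < 2")
  case True
  have "E \<subseteq> descendants T0"
    using H unfolding history_def by blast
  from card_low_level[OF fin this True] show ?thesis
    by (simp add: level_events_def)
next
  case False
  then obtain r where r: "q = r + 2"
    by (metis add.commute le_Suc_ex not_less)
  have "covered (Suc r) (level_events E (r + 2))"
    using H unfolding history_def by blast
  then obtain u v w where sub: "level_events E q \<subseteq> near (Suc r) u \<union> near (Suc r) v \<union> near (Suc r) w"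
    unfolding covered_def r by blast
  have near: "finite (near (Suc r) z)" "card (near (Suc r) z) \<le> 56 * N" for z
    using card_near[OF fin, of "Suc r" z] card_star_nu[of "Suc r" z] nu by auto
  have "card (level_events E q) \<le> card (near (Suc r) u \<union> near (Suc r) v \<union> near (Suc r) w)"
    using near(1) by (intro card_mono sub) auto
  also have "\<dots> \<le> card (near (Suc r) u) + card (near (Suc r) v) + card (near (Suc r) w)"
    by (meson add_le_mono1 card_Un_le order_trans)
  also have "\<dots> \<le> 168 * N"
    using near(2)[of u] near(2)[of v] near(2)[of w] by simp
  finally show ?thesis by simp
qed

text \<open>Grouped by level, the sum is dominated by a geometric series starting at the level of
  \<open>K\<close>, the lowest in \<open>E\<close>.\<close>

lemma sum_diameters:
  assumes fin: "finite T0" and H: "history par R E K" and nu: "nu T0 = enat N" and Ch: "Ch > 0"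
    and diam: "\<And>K. K \<in> descendants T0 \<Longrightarrow> diameter (body K) \<le> Ch * 2 powi (- int (lvl T0 K))"
  shows "(\<Sum>L\<in>E. diameter (body L)) \<le>
    2 * max (448 * real (card T0)) (630 * real N) * Ch * (1 / 2) ^ lvl T0 K"
proof -
  let ?H = "max (448 * real (card T0)) (630 * real N)"
  have h: "finite E" "E \<subseteq> descendants T0" "\<And>L. L \<in> E \<Longrightarrow> lvl T0 K \<le> lvl T0 L"
    using H unfolding history_def by blast+
  have "(\<Sum>L\<in>E. diameter (body L)) \<le> (\<Sum>L\<in>E. Ch * (1 / 2) ^ lvl T0 L)"
    using diam h(2) by (intro sum_mono) (auto simp: powi_neg_eq)
  also have "\<dots> = (\<Sum>q\<in>lvl T0 ` E. \<Sum>L\<in>{L \<in> E. lvl T0 L = q}. Ch * (1 / 2) ^ lvl T0 L)"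
    using h(1) by (rule sum.image_gen)
  also have "\<dots> = (\<Sum>q\<in>lvl T0 ` E. real (card (level_events E q)) * (Ch * (1 / 2) ^ q))"
    by (intro sum.cong) (auto simp: level_events_def)
  also have "\<dots> \<le> (\<Sum>q\<in>lvl T0 ` E. ?H * (Ch * (1 / 2) ^ q))"
    using card_level_events[OF fin H nu] Ch by (intro sum_mono mult_right_mono) auto
  also have "\<dots> = ?H * Ch * (\<Sum>q\<in>lvl T0 ` E. (1 / 2) ^ q)"
    by (simp add: sum_distrib_left mult.assoc)
  also have "\<dots> \<le> ?H * Ch * (2 * (1 / 2) ^ lvl T0 K)"
    using h(1,3) Ch by (intro mult_left_mono sum_geometric_le) (auto simp: max_def)
  finally show ?thesis by (simp add: mult_ac)
qed

end

lemma max_ereal_real: "max (448 * ereal a) (630 * ereal b) = ereal (max (448 * a) (630 * b))"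
  by (simp add: max_def)

theorem theorem5p1:
  fixes \<Omega> :: "point set" and T0 \<T> \<M> \<T>' :: "marked_tet set"
    and par :: "marked_tet \<Rightarrow> marked_tet" and Ch :: real and T :: marked_tet
  assumes "polyhedral_domain \<Omega>" and "initial_mesh \<Omega> T0"
    and "Ch > 0"
    and "\<forall>K\<in>descendants T0. diameter (body K) \<le> Ch * 2 powi (- int (lvl T0 K))"
    and "descendant_mesh T0 \<T>" and "conformingly_marked \<T>"
    and "\<M> \<subseteq> \<T>"
    and "\<T>' = refine_AMP \<T> \<M>"
    and "causal_forest \<T> \<M> par"
    and "T \<in> \<T>' - \<T>"
  shows "\<exists>M\<in>\<M>. \<exists>K\<in>events \<T> \<M>.
           T \<in> children K \<and> causal_chain \<T> \<M> par M K \<and>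
           lvl T0 T \<le> lvl T0 M + 1 \<and>
           ereal (setdist (body T) (body M)) \<le> R_AMP T0 Ch * ereal (2 powi (- int (lvl T0 T)))"
proof -
  interpret amp_forest T0
    by (rule amp_forest.intro[OF initial_compatible[OF assms(2)]])
  interpret amp_call T0 \<T> \<M>
    by unfold_locales (use separated_descendant_mesh assms(5,7) in auto)
  have fin: "finite T0"
    using assms(2) by (simp add: initial_mesh_def marked_mesh_def)
  obtain k where "T \<in> call_mesh \<T> \<M> k" "T \<notin> \<T>"
    using assms(8,10) by (auto simp: refine_AMP_def)
  then obtain n K where K: "K \<in> batch \<T> \<M> n" "T \<in> children K"
    using new_element_parent by blast
  have KD: "K \<in> descendants T0"
    using K(1) batch_subset call_descendants by blast
  obtain R E where H: "history par R E K"
    using history_exists[OF assms(9) K(1)] by blast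
  then have h: "R \<in> \<M>" "R \<in> E" "causal_chain \<T> \<M> par R K" "lvl T0 K \<le> lvl T0 R"
    "\<forall>x\<in>body K. \<exists>y\<in>body R. dist x y \<le> (\<Sum>L\<in>E. diameter (body L))"
    unfolding history_def by blast+
  have lT: "lvl T0 T \<le> lvl T0 K + 1"
    using lvl_child[OF KD K(2)] .
  have "ereal (setdist (body T) (body R)) \<le> R_AMP T0 Ch * ereal (2 powi (- int (lvl T0 T)))"
  proof (cases "nu T0")
    case (enat N)
    let ?H = "max (448 * real (card T0)) (630 * real N)"
    have TD: "proper T"
      using descendant_proper[OF children_descendants(1)[OF KD K(2)]] .
    then have "verts T \<noteq> {}"
      by (auto simp: proper_def tetrahedron_def)
    \<comment> \<open>One point of \<open>T\<close> suffices: it lies in \<open>K\<close>, and every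
      point of \<open>K\<close> is linked to \<open>R\<close> by the diameters along the
      chain.\<close>
    then obtain x where x: "x \<in> body T"
      using verts_subset_body by blast
    obtain j where j: "K \<in> uniform T0 j"
      using KD by (auto simp: descendants_def)
    have "T \<in> uniform {K} (Suc 0)"
      using K(2) by simp
    then have "body T \<subseteq> body K"
      using uniform_body_subset[OF base_plain j] by blast
    then obtain y where y: "y \<in> body R" "dist x y \<le> (\<Sum>L\<in>E. diameter (body L))"
      using h(5) x by blast
    have H0: "0 \<le> ?H" by (simp add: max_def)
    have "setdist (body T) (body R) \<le> dist x y"
      using setdist_le_dist[OF x y(1)] .
    also have "\<dots> \<le> 2 * ?H * Ch * (1 / 2) ^ lvl T0 K"
      using y(2) sum_diameters[OF fin H enat assms(3)] assms(4) by fastforce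
    \<comment> \<open>Passing from the level of \<open>K\<close> to that of \<open>T\<close> costs
      the second factor 2.\<close>
    also have "(1 / 2 :: real) ^ lvl T0 K \<le> 2 * (1 / 2) ^ lvl T0 T"
      using power_decreasing[OF lT, of "1 / 2 :: real"] by simp
    then have "2 * ?H * Ch * (1 / 2) ^ lvl T0 K \<le> 2 * ?H * Ch * (2 * (1 / 2) ^ lvl T0 T)"
      using H0 assms(3) by (intro mult_left_mono) auto
    finally have "setdist (body T) (body R) \<le> 4 * ?H * Ch * (1 / 2) ^ lvl T0 T"
      by (simp add: mult_ac)
    moreover have "R_AMP T0 Ch = ereal (4 * ?H * Ch)"
    proof -
      have "H_AMP T0 = ereal ?H"
        unfolding H_AMP_def enat ereal_of_enat_simps by (rule max_ereal_real)
      then show ?thesis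
        unfolding R_AMP_def by (simp only: numeral_eq_ereal times_ereal.simps)
    qed
    ultimately show ?thesis
      by (simp add: powi_neg_eq)
  next
    case infinity
    \<comment> \<open>With infinite \<nu> the right-hand side is infinite, since \<open>Ch\<close>
      is positive.\<close>
    then have "H_AMP T0 = \<infinity>"
      by (simp add: H_AMP_def)
    then have "R_AMP T0 Ch = \<infinity>"
      using assms(3) by (simp add: R_AMP_def)
    then show ?thesis by simp
  qed
  moreover have "lvl T0 T \<le> lvl T0 R + 1"
    using lT h(4) by linarith
  moreover have "K \<in> events \<T> \<M>"
    using K(1) by (auto simp: events_def)
  ultimately show ?thesis
    using h(1,3) K(2) by blast
qed

end
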